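(* The following series converge uniformly on each compact subset of $\mathbb{C}\times\mathbb{C}$ and satisfy \[ \sqrt{\frac2\pi}\,\frac{e^{-i\pi x}}{2i\sin(\pi x)}\int_{-\infty}^{(0+)}\frac{e^{\lambda}(-\lambda)^{-x-1}\lambda^{-1/2}\cos\sqrt{\lambda^2-2\lambda t}}{\Gamma(-x)}\,d\lambda=\sum_{n=0}^\infty J^\Delta_{n-\frac12}(x)\frac{t^n}{n!}, \] \[ \sqrt{\frac2\pi}\,\frac{e^{-i\pi x}}{2i\sin(\pi x)}\int_{-\infty}^{(0+)}\frac{e^{\lambda}(-\lambda)^{-x-1}\lambda^{-1/2}\sin\sqrt{\lambda^2+2\lambda t}}{\Gamma(-x)}\,d\lambda=\sum_{n=0}^\infty J^\Delta_{-n+\frac12}(x)\frac{t^n}{n!}. \]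
   Context: $(x)_\mu:=\Gamma(x+1)/\Gamma(x+1-\mu)$; the difference Bessel function is $J^\Delta_\mu(x)=\sum_{k=0}^\infty\frac{(-1)^k}{2^{\mu+2k}k!\,\Gamma(\mu+k+1)}(x)_{\mu+2k}$. The integrals are over a Hankel contour starting at $-\infty$ below the negative real axis, circling the origin counterclockwise and returning to $-\infty$ above the negative real axis, with principal branches of the powers.
   Formalization: Compact sets must lie where all the J^Δ series converge and Γ(x+1) has no pole; identities need such x, non-integer. (-λ)^{-x-1} is continued along the contour from its principal value on the upper edge; the sine root is λ√(1+2t/λ), the contour radius exceeding 2|t|. *)

theory Defs
  imports "HOL-Complex_Analysis.Complex_Analysis"
begin

definition gen_fall :: "complex \<Rightarrow> complex \<Rightarrow> complex" where
  "gen_fall x \<mu> = Gamma (x + 1) * rGamma (x + 1 - \<mu>)"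

definition dBessel_term :: "complex \<Rightarrow> complex \<Rightarrow> nat \<Rightarrow> complex" where
  "dBessel_term \<mu> x k =
     (-1) ^ k / (2 powr (\<mu> + 2 * of_nat k) * fact k) * rGamma (\<mu> + of_nat k + 1)
       * gen_fall x (\<mu> + 2 * of_nat k)"

definition dBesselJ :: "complex \<Rightarrow> complex \<Rightarrow> complex" where
  "dBesselJ \<mu> x = (\<Sum>k. dBessel_term \<mu> x k)"

text \<open>Hankel contour integral from -infinity (below the negative real axis) around 0
  counterclockwise back to -infinity (above the negative real axis), consisting of the
  two rays r \<ge> \<rho> on the two edges of the cut and the circle of radius \<rho>.
  The integrand F is given as a function of the logarithm l of the integration
  variable lambda = exp l, taken continuously along the contour (Im l = -pi on the lower
  ray, Im l runs from -pi to pi on the circle, Im l = pi on the upper ray); this fixes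
  all branches unambiguously.  The value is  integral of F(l) d lambda.\<close>
definition hankel_integral :: "real \<Rightarrow> (complex \<Rightarrow> complex) \<Rightarrow> complex" where
  "hankel_integral \<rho> F =
     integral {ln \<rho>..} (\<lambda>u. F (Complex u pi) * exp (Complex u pi))
   - integral {ln \<rho>..} (\<lambda>u. F (Complex u (- pi)) * exp (Complex u (- pi)))
   + contour_integral (linepath (Complex (ln \<rho>) (- pi)) (Complex (ln \<rho>) pi))
       (\<lambda>l. F l * exp l)"

text \<open>Integrands.  With lambda = exp l:  lambda^(-1/2) = exp(-l/2) (principal),
  (-lambda)^(-x-1) = exp((-x-1)*(l - i pi)) (principal on the final, upper edge, continued
  along the contour), sqrt(lambda^2 - 2 lambda t) inside cos (cos of sqrt is even, so any
  branch), and sqrt(lambda^2 + 2 lambda t) = lambda * sqrt(1 + 2t/lambda), the branch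
  analytic for |lambda| > 2|t| and asymptotic to lambda.\<close>
definition hankel_cos_integrand :: "complex \<Rightarrow> complex \<Rightarrow> complex \<Rightarrow> complex" where
  "hankel_cos_integrand x t l =
     exp (exp l) * exp ((- x - 1) * (l - \<i> * of_real pi)) * exp (- l / 2)
       * cos (csqrt ((exp l)\<^sup>2 - 2 * exp l * t)) * rGamma (- x)"

definition hankel_sin_integrand :: "complex \<Rightarrow> complex \<Rightarrow> complex \<Rightarrow> complex" where
  "hankel_sin_integrand x t l =
     exp (exp l) * exp ((- x - 1) * (l - \<i> * of_real pi)) * exp (- l / 2)
       * sin (exp l * csqrt (1 + 2 * t / exp l)) * rGamma (- x)"

definition hankel_prefactor :: "complex \<Rightarrow> complex" where
  "hankel_prefactor x =
     of_real (sqrt (2 / pi)) * exp (- \<i> * of_real pi * x) / (2 * \<i> * sin (of_real pi * x))"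

end

theory Submission
  imports Defs
begin

text \<open>Hankel's formula \<open>\<integral> exp \<lambda> * \<lambda> powr (- z) d\<lambda> = 2 * \<pi> * \<i> / \<Gamma>(z)\<close> turns the terms of
  \<open>J\<^sup>\<Delta>\<^sub>\<mu>(x)\<close> into the terms of the Hankel integral of \<open>exp \<lambda> * \<lambda> powr (- x - 1) * J\<^sub>\<mu>(a * \<lambda>)\<close>
  at \<open>a = 1\<close>. For \<open>0 \<le> a < 1\<close> sum and integral may be interchanged by absolute convergence, and
  \<open>a \<rightarrow> 1\<close> is Abel's theorem on the side of the series and dominated convergence on the side of the
  integral. The functions \<open>sqrt (\<pi> * \<lambda> / 2) * J\<^sub>\<mu>(\<lambda>)\<close> with \<open>\<mu> = n - 1/2\<close> and \<open>\<mu> = 1/2 - n\<close> are the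
  \<open>n\<close>-th derivatives at \<open>t = 0\<close> of the cosine and of the sine in the theorem. On the rays of the
  contour those grow at most like \<open>exp (sqrt (2 * \<bar>\<lambda>\<bar> * \<bar>t\<bar>))\<close>, so Cauchy's inequalities bound the
  derivatives by \<open>n! / R ^ n\<close> times a function that \<open>exp \<lambda>\<close> dominates. This justifies integrating the
  Taylor series in \<open>t\<close> termwise and gives the locally uniform convergence.\<close>

subsection \<open>Hankel integrals\<close>

text \<open>In the logarithm \<open>l\<close> every power of \<lambda> is entire, and a Hankel
  integral becomes the limiting jump of a primitive between \<open>Im l = pi\<close> and
  \<open>Im l = - pi\<close>. The detour through \<open>a < 1\<close> has a reason: on the rays,
  with |\<lambda>| = r, the absolute values of the terms of
  \<open>J\<^sub>\<mu>(a * \<lambda>)\<close> add up to about exp (a r), so at a = 1 they use up the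
  whole decay of exp \<lambda>. The function itself is far smaller by cancellation, which only the
  closed forms reveal. One estimate of \<open>bessel_gen\<close> therefore serves three times: for
  fixed n as majorant in the limit a \<rightarrow> 1, with its factor n!/R^n for termwise
  integration, and again for the Weierstrass test. In it exp (sqrt (2 r R)) is weakened to exp (R +
  r/2), which still leaves exp (- r/2) of the decay. Cosine and sine differ in one respect. The
  cosine is even in the root, hence entire in t, and every R is allowed. The sine has a branch point
  at t = - \<lambda>/2, which ties R to the radius of the contour. Large compact sets then ask for
  large radii, which is legitimate because the coefficients of the series do not involve
  \<rho>.\<close>

definition hankel_path :: "real \<Rightarrow> complex set" where
  "hankel_path \<rho> = {l. ln \<rho> \<le> Re l \<and> (Im l = pi \<or> Im l = - pi) \<or> Re l = ln \<rho> \<and> \<bar>Im l\<bar> \<le> pi}"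

lemma half_line_dominated:
  fixes f :: "real \<Rightarrow> complex"
  assumes "continuous_on {c..} f" "\<And>u. u \<ge> c \<Longrightarrow> norm (f u) \<le> M * exp (- u)"
  shows "f integrable_on {c..}" "norm (integral {c..} f) \<le> M * exp (- c)"
proof -
  have h: "((\<lambda>u. M * exp (- u)) has_integral M * exp (- c)) {c..}"
    using has_integral_mult_right[OF has_integral_exp_minus_to_infinity[of 1 c], of M] by simp
  show f: "f integrable_on {c..}"
  proof (rule measurable_bounded_by_integrable_imp_integrable)
    show "f \<in> borel_measurable (lebesgue_on {c..})"
      by (intro continuous_imp_measurable_on_sets_lebesgue assms) auto
    show "(\<lambda>u. M * exp (- u)) integrable_on {c..}" using h by blast
  qed (use assms in auto)
  show "norm (integral {c..} f) \<le> M * exp (- c)"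
    unfolding integral_unique[OF h, symmetric]
    by (rule integral_norm_bound_integral[OF f]) (use h assms in auto)
qed

text \<open>Parametrising the circle by \<open>{0..1}\<close> turns all three pieces into ordinary
  integrals, so that estimates and dominated convergence treat them alike.\<close>

lemma hankel_integral_eq:
  "hankel_integral \<rho> F =
     integral {ln \<rho>..} (\<lambda>u. F (Complex u pi) * exp (Complex u pi))
   - integral {ln \<rho>..} (\<lambda>u. F (Complex u (- pi)) * exp (Complex u (- pi)))
   + integral {0..1} (\<lambda>s. F (Complex (ln \<rho>) ((2 * s - 1) * pi)) * exp (Complex (ln \<rho>) ((2 * s - 1) * pi)))
       * (2 * \<i> * of_real pi)"
proof -
  have 1: "linepath (Complex (ln \<rho>) (- pi)) (Complex (ln \<rho>) pi) s = Complex (ln \<rho>) ((2 * s - 1) * pi)" for s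
    by (simp add: linepath_def complex_eq_iff algebra_simps)
  have 2: "Complex (ln \<rho>) pi - Complex (ln \<rho>) (- pi) = 2 * \<i> * of_real pi"
    by (simp add: complex_eq_iff)
  show ?thesis
    unfolding hankel_integral_def contour_integral_integral vector_derivative_linepath_at 1 2
    by simp
qed

lemma continuous_on_vertical [continuous_intros]:
  assumes "continuous_on A f" "continuous_on A g"
  shows "continuous_on A (\<lambda>x. Complex (f x) (g x))"
  unfolding Complex_eq using assms by (intro continuous_intros)

lemma continuous_on_hankel_piece:
  assumes "continuous_on UNIV F" "continuous_on A f" "continuous_on A g"
  shows "continuous_on A (\<lambda>x. F (Complex (f x) (g x)) * exp (Complex (f x) (g x)))"
  by (intro continuous_intros continuous_on_compose2[OF assms(1)] assms) auto

lemma hankel_pathI [simp]: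
  "u \<ge> ln \<rho> \<Longrightarrow> Complex u pi \<in> hankel_path \<rho>"
  "u \<ge> ln \<rho> \<Longrightarrow> Complex u (- pi) \<in> hankel_path \<rho>"
  "0 \<le> s \<Longrightarrow> s \<le> 1 \<Longrightarrow> Complex (ln \<rho>) ((2 * s - 1) * pi) \<in> hankel_path \<rho>"
proof -
  show "Complex (ln \<rho>) ((2 * s - 1) * pi) \<in> hankel_path \<rho>" if "0 \<le> s" "s \<le> 1"
  proof -
    have "\<bar>2 * s - 1\<bar> * pi \<le> 1 * pi" using that by (intro mult_right_mono) auto
    then show ?thesis by (simp add: hankel_path_def abs_mult)
  qed
qed (simp_all add: hankel_path_def)

text \<open>The majorant amounts to |F| \<le> M / |\<lambda>|^2 on the contour. It is integrable
  along the rays, stable under sums and scalar multiples, and bounds the integral linearly in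
  \<open>M\<close>. Continuity is asked everywhere because the kernels it is applied to are entire
  in \<open>l\<close>.\<close>

locale hankel_bounded =
  fixes \<rho> :: real and F :: "complex \<Rightarrow> complex" and M :: real
  assumes cont: "continuous_on UNIV F"
    and bound: "\<And>l. l \<in> hankel_path \<rho> \<Longrightarrow> norm (F l * exp l) \<le> M * exp (- Re l)"
begin

lemma integrable:
  "(\<lambda>u. F (Complex u pi) * exp (Complex u pi)) integrable_on {ln \<rho>..}"
  "(\<lambda>u. F (Complex u (- pi)) * exp (Complex u (- pi))) integrable_on {ln \<rho>..}"
  "(\<lambda>s. F (Complex (ln \<rho>) ((2 * s - 1) * pi)) * exp (Complex (ln \<rho>) ((2 * s - 1) * pi))) integrable_on {0..1}"
  using bound[OF hankel_pathI(1)] bound[OF hankel_pathI(2)]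
  by (intro half_line_dominated(1)[where M = M] integrable_continuous_interval continuous_on_hankel_piece cont
        continuous_intros; simp)+

lemma norm_hankel_integral_le:
  "norm (hankel_integral \<rho> F) \<le> M * exp (- ln \<rho>) * (2 + 2 * pi)"
proof -
  have 1: "norm (integral {ln \<rho>..} (\<lambda>u. F (Complex u pi) * exp (Complex u pi))) \<le> M * exp (- ln \<rho>)"
    using bound[OF hankel_pathI(1)]
    by (intro half_line_dominated(2) continuous_on_hankel_piece cont continuous_intros) auto
  have 2: "norm (integral {ln \<rho>..} (\<lambda>u. F (Complex u (- pi)) * exp (Complex u (- pi)))) \<le> M * exp (- ln \<rho>)"
    using bound[OF hankel_pathI(2)]
    by (intro half_line_dominated(2) continuous_on_hankel_piece cont continuous_intros) auto
  have 3: "norm (integral {0..1} (\<lambda>s. F (Complex (ln \<rho>) ((2 * s - 1) * pi)) * exp (Complex (ln \<rho>) ((2 * s - 1) * pi))))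
       \<le> M * exp (- ln \<rho>) * (1 - 0)"
    using bound[OF hankel_pathI(3)]
    by (intro integral_bound continuous_on_hankel_piece cont continuous_intros) auto
  have "norm (hankel_integral \<rho> F) \<le> M * exp (- ln \<rho>) + M * exp (- ln \<rho>) + M * exp (- ln \<rho>) * (2 * pi)"
    unfolding hankel_integral_eq using 1 2 3
    by (intro order.trans[OF norm_triangle_ineq] add_mono order.trans[OF norm_triangle_ineq4])
       (auto simp: norm_mult intro!: mult_right_mono)
  then show ?thesis by (simp add: algebra_simps)
qed

end

lemma hankel_bounded_add:
  assumes "hankel_bounded \<rho> F M" "hankel_bounded \<rho> G N"
  shows "hankel_bounded \<rho> (\<lambda>l. F l + G l) (M + N)"
    and "hankel_integral \<rho> (\<lambda>l. F l + G l) = hankel_integral \<rho> F + hankel_integral \<rho> G"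
proof -
  interpret F: hankel_bounded \<rho> F M by fact
  interpret G: hankel_bounded \<rho> G N by fact
  show "hankel_bounded \<rho> (\<lambda>l. F l + G l) (M + N)"
  proof
    show "norm ((F l + G l) * exp l) \<le> (M + N) * exp (- Re l)" if "l \<in> hankel_path \<rho>" for l
      using norm_triangle_ineq[of "F l * exp l" "G l * exp l"] F.bound[OF that] G.bound[OF that]
      by (simp add: ring_distribs)
  qed (intro continuous_intros F.cont G.cont)
  show "hankel_integral \<rho> (\<lambda>l. F l + G l) = hankel_integral \<rho> F + hankel_integral \<rho> G"
    unfolding hankel_integral_eq ring_distribs
    using F.integrable G.integrable by (simp add: integral_add algebra_simps)
qed

lemma hankel_integral_cmult: "hankel_integral \<rho> (\<lambda>l. c * F l) = c * hankel_integral \<rho> F"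
  unfolding hankel_integral_eq by (simp add: mult.assoc algebra_simps)

lemma hankel_bounded_cmult:
  assumes "hankel_bounded \<rho> F M"
  shows "hankel_bounded \<rho> (\<lambda>l. c * F l) (norm c * M)"
proof -
  interpret hankel_bounded \<rho> F M by fact
  show ?thesis
  proof
    show "norm (c * F l * exp l) \<le> norm c * M * exp (- Re l)" if "l \<in> hankel_path \<rho>" for l
      using mult_left_mono[OF bound[OF that], of "norm c"] by (simp add: norm_mult mult_ac)
  qed (intro continuous_intros cont)
qed

lemma hankel_bounded_zero: "hankel_bounded \<rho> (\<lambda>l. 0) 0"
  by standard auto

lemma hankel_bounded_sum:
  assumes "\<And>i::nat. hankel_bounded \<rho> (F i) (M i)"
  shows "hankel_bounded \<rho> (\<lambda>l. \<Sum>i<n. F i l) (\<Sum>i<n. M i)"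
    and "hankel_integral \<rho> (\<lambda>l. \<Sum>i<n. F i l) = (\<Sum>i<n. hankel_integral \<rho> (F i))"
proof -
  have "hankel_bounded \<rho> (\<lambda>l. \<Sum>i<n. F i l) (\<Sum>i<n. M i) \<and>
        hankel_integral \<rho> (\<lambda>l. \<Sum>i<n. F i l) = (\<Sum>i<n. hankel_integral \<rho> (F i))"
  proof (induction n)
    case 0
    show ?case using hankel_bounded_zero hankel_integral_cmult[of \<rho> 0 "\<lambda>l. 0"] by simp
  next
    case (Suc n)
    then show ?case
      using hankel_bounded_add[OF _ assms[of n], of "\<lambda>l. \<Sum>i<n. F i l" "\<Sum>i<n. M i"] by simp
  qed
  then show "hankel_bounded \<rho> (\<lambda>l. \<Sum>i<n. F i l) (\<Sum>i<n. M i)"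
    and "hankel_integral \<rho> (\<lambda>l. \<Sum>i<n. F i l) = (\<Sum>i<n. hankel_integral \<rho> (F i))" by blast+
qed

text \<open>The limit \<open>G\<close> is constrained on the contour only: for t \<noteq> 0 the sine
  integrand jumps elsewhere, where 1 + 2 t / \<lambda> crosses the cut of
  \<open>csqrt\<close>.\<close>

lemma hankel_dominated_convergence:
  assumes "\<And>k::nat. hankel_bounded \<rho> (F k) M"
    and lim: "\<And>l. l \<in> hankel_path \<rho> \<Longrightarrow> (\<lambda>k. F k l) \<longlonglongrightarrow> G l"
  shows "(\<lambda>k. hankel_integral \<rho> (F k)) \<longlonglongrightarrow> hankel_integral \<rho> G"
proof -
  interpret F: hankel_bounded \<rho> "F k" M for k by fact
  have h: "(\<lambda>u. M * exp (- u)) integrable_on {ln \<rho>..}"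
    using integrable_on_mult_right[OF integrable_on_exp_minus_to_infinity[of 1 "ln \<rho>"], of M] by simp
  show ?thesis
    unfolding hankel_integral_eq
    using F.bound[OF hankel_pathI(1)] F.bound[OF hankel_pathI(2)] F.bound[OF hankel_pathI(3)]
    by (intro tendsto_intros dominated_convergence(2)[OF _ h]
          dominated_convergence(2)[where h = "\<lambda>s. M * exp (- ln \<rho>)"] F.integrable lim)
       auto
qed

lemma hankel_integral_sums:
  assumes F: "\<And>k::nat. hankel_bounded \<rho> (F k) (M k)" and M: "summable M"
    and sums: "\<And>l. l \<in> hankel_path \<rho> \<Longrightarrow> (\<lambda>k. F k l) sums G l"
  shows "(\<lambda>k. hankel_integral \<rho> (F k)) sums hankel_integral \<rho> G"
proof -
  \<comment> \<open>The sign follows from the bound at a corner of the contour, a point that always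
    lies in \<open>hankel_path\<close>.\<close>
  have M_nonneg: "0 \<le> M k" for k
  proof -
    interpret hankel_bounded \<rho> "F k" "M k" by fact
    have "0 \<le> M k * exp (- Re (Complex (ln \<rho>) pi))"
      using bound[of "Complex (ln \<rho>) pi"] by (intro order.trans[OF norm_ge_zero]) auto
    then show ?thesis by (simp add: zero_le_mult_iff)
  qed
  \<comment> \<open>A single constant for all partial sums reduces the interchange to dominated
    convergence.\<close>
  have "hankel_bounded \<rho> (\<lambda>l. \<Sum>i<n. F i l) (suminf M)" for n
  proof -
    interpret S: hankel_bounded \<rho> "\<lambda>l. \<Sum>i<n. F i l" "\<Sum>i<n. M i"
      by (rule hankel_bounded_sum(1)[OF F])
    have "(\<Sum>i<n. M i) \<le> suminf M" using sum_le_suminf[OF M] M_nonneg by simp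
    then show ?thesis
      by unfold_locales (auto intro!: S.cont order.trans[OF S.bound] mult_right_mono)
  qed
  then have "(\<lambda>n. hankel_integral \<rho> (\<lambda>l. \<Sum>i<n. F i l)) \<longlonglongrightarrow> hankel_integral \<rho> G"
    using sums unfolding sums_def by (rule hankel_dominated_convergence)
  then show ?thesis
    unfolding sums_def hankel_bounded_sum(2)[OF F] .
qed

section \<open>Evaluation of Hankel integrals by primitives\<close>

lemma half_line_integral_limit:
  fixes f :: "real \<Rightarrow> complex"
  assumes "f absolutely_integrable_on {c..}"
  shows "(\<lambda>k. integral {c..c + real k} f) \<longlonglongrightarrow> integral {c..} f"
proof -
  have "(\<lambda>k. integral {c..} (\<lambda>u. if u \<in> {c..c + real k} then f u else 0)) \<longlonglongrightarrow> integral {c..} f"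
  proof (rule dominated_convergence(2)[where h = "\<lambda>u. norm (f u)"])
    fix k
    have "f integrable_on {c..c + real k}"
      using set_integrable_subset[OF assms, of "{c..c + real k}"] set_lebesgue_integral_eq_integral(1)
      by auto
    then show "(\<lambda>u. if u \<in> {c..c + real k} then f u else 0) integrable_on {c..}"
      by (subst integrable_restrict_Int) (auto simp: Int_absorb2 Int_absorb1)
  next
    fix u assume u: "u \<in> {c..}"
    have "\<forall>\<^sub>F k in sequentially. (if u \<in> {c..c + real k} then f u else 0) = f u"
      using eventually_ge_at_top[of "nat \<lceil>u - c\<rceil>"]
      by eventually_elim (use u in \<open>auto simp: nat_le_iff ceiling_le_iff\<close>)
    then show "(\<lambda>k. if u \<in> {c..c + real k} then f u else 0) \<longlonglongrightarrow> f u"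
      by (rule tendsto_eventually)
  qed (use assms in \<open>auto simp: absolutely_integrable_on_def\<close>)
  moreover have "integral {c..} (\<lambda>u. if u \<in> {c..c + real k} then f u else 0) = integral {c..c + real k} f" for k
    by (subst integral_restrict_Int) (auto simp: Int_absorb2 Int_absorb1)
  ultimately show ?thesis by simp
qed

lemma half_line_dominated_limit:
  fixes f :: "real \<Rightarrow> complex"
  assumes "continuous_on {c..} f" "\<And>u. u \<ge> c \<Longrightarrow> norm (f u) \<le> M * exp (- u)"
  shows "(\<lambda>k. integral {c..c + real k} f) \<longlonglongrightarrow> integral {c..} f"
proof (rule half_line_integral_limit)
  have "(\<lambda>u. M * exp (- u)) integrable_on {c..}"
    using integrable_on_mult_right[OF integrable_on_exp_minus_to_infinity[of 1 c], of M] by simp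
  then show "f absolutely_integrable_on {c..}"
    using assms by (intro absolutely_integrable_integrable_bound[where g = "\<lambda>u. M * exp (- u)"]
          half_line_dominated(1)) auto
qed

text \<open>The vertical segment joins the two rays, so all three pieces telescope.\<close>
lemma hankel_integral_primitive:
  assumes "hankel_bounded \<rho> F M"
    and P: "\<And>l. (P has_field_derivative F l * exp l) (at l)"
  shows "(\<lambda>k. P (Complex (ln \<rho> + real k) pi) - P (Complex (ln \<rho> + real k) (- pi)))
           \<longlonglongrightarrow> hankel_integral \<rho> F"
proof -
  interpret hankel_bounded \<rho> F M by fact
  define c where "c = ln \<rho>"
  have ray: "integral {c..c + real k} (\<lambda>u. F (Complex u y) * exp (Complex u y))
             = P (Complex (c + real k) y) - P (Complex c y)" for k y
  proof (rule integral_unique, rule fundamental_theorem_of_calculus)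
    fix u
    have "((\<lambda>u. Complex u y) has_vector_derivative 1) (at u within {c..c + real k})"
      unfolding Complex_eq by (auto intro!: derivative_eq_intros)
    from field_vector_diff_chain_within[OF this, of P "F (Complex u y) * exp (Complex u y)"]
    show "((\<lambda>u. P (Complex u y)) has_vector_derivative F (Complex u y) * exp (Complex u y))
            (at u within {c..c + real k})"
      using P by (auto simp: o_def has_field_derivative_at_within)
  qed simp
  have seg: "contour_integral (linepath (Complex c (- pi)) (Complex c pi)) (\<lambda>l. F l * exp l)
      = P (Complex c pi) - P (Complex c (- pi))"
    using contour_integral_primitive[of UNIV P "\<lambda>l. F l * exp l" "linepath (Complex c (- pi)) (Complex c pi)"] P
    by (intro contour_integral_unique) auto
  have 1: "(\<lambda>k. P (Complex (c + real k) pi) - P (Complex c pi))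
      \<longlonglongrightarrow> integral {c..} (\<lambda>u. F (Complex u pi) * exp (Complex u pi))"
    unfolding ray[symmetric] using bound[OF hankel_pathI(1)]
    by (intro half_line_dominated_limit[where M = M] continuous_on_hankel_piece cont continuous_intros) (auto simp: c_def)
  have 2: "(\<lambda>k. P (Complex (c + real k) (- pi)) - P (Complex c (- pi)))
      \<longlonglongrightarrow> integral {c..} (\<lambda>u. F (Complex u (- pi)) * exp (Complex u (- pi)))"
    unfolding ray[symmetric] using bound[OF hankel_pathI(2)]
    by (intro half_line_dominated_limit[where M = M] continuous_on_hankel_piece cont continuous_intros) (auto simp: c_def)
  have "(\<lambda>k. (P (Complex (c + real k) pi) - P (Complex c pi)) - (P (Complex (c + real k) (- pi)) - P (Complex c (- pi)))
      + (P (Complex c pi) - P (Complex c (- pi)))) \<longlonglongrightarrow> hankel_integral \<rho> F"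
    unfolding hankel_integral_def c_def[symmetric] seg
    by (intro tendsto_intros 1 2)
  then show ?thesis by (simp add: c_def)
qed

subsection \<open>Hankel's formula for the reciprocal Gamma function\<close>

lemma hankel_pathD:
  assumes "l \<in> hankel_path \<rho>"
  shows "ln \<rho> \<le> Re l" "\<bar>Im l\<bar> \<le> pi"
  using assms by (auto simp: hankel_path_def)

text \<open>On the rays \<open>Re (exp l) = - exp (Re l)\<close>; on the circle there is only
  \<open>Re (exp l) \<le> \<rho> = 2 * \<rho> - exp (Re l)\<close>. The \<open>2 * \<rho>\<close>
  lets one formula cover both.\<close>

lemma norm_exp_exp_hankel_path:
  assumes "l \<in> hankel_path \<rho>" "\<rho> > 0"
  shows "norm (exp (exp l)) \<le> exp (2 * \<rho> - exp (Re l))"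
proof -
  have "Re (exp l) \<le> 2 * \<rho> - exp (Re l)"
  proof (cases "Re l = ln \<rho>")
    case True
    have "Re (exp l) \<le> norm (exp l)" by (rule complex_Re_le_cmod)
    with True show ?thesis using assms by (simp add: norm_exp_eq_Re)
  next
    case False
    with assms have "Im l = pi \<or> Im l = - pi" by (auto simp: hankel_path_def)
    then have "Re (exp l) = - exp (Re l)" by (auto simp: Re_exp)
    then show ?thesis using assms by simp
  qed
  then show ?thesis by (simp add: norm_exp_eq_Re)
qed

lemma norm_exp_mult_hankel_path:
  assumes "l \<in> hankel_path \<rho>"
  shows "norm (exp (z * l)) \<le> exp (pi * \<bar>Im z\<bar>) * exp (Re z * Re l)"
proof -
  have "- (Im z * Im l) \<le> \<bar>Im z\<bar> * \<bar>Im l\<bar>" by (metis abs_ge_minus_self abs_mult)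
  also have "\<dots> \<le> \<bar>Im z\<bar> * pi" using hankel_pathD[OF assms] by (intro mult_left_mono) auto
  finally show ?thesis by (simp add: norm_exp_eq_Re mult_ac flip: exp_add)
qed

text \<open>For \<open>u \<ge> 0\<close> the inequality \<open>u\<^sup>2 / 2 \<le> exp u\<close>
  leaves a quadratic exponent, maximised by completing the square; for \<open>c \<le> u < 0\<close>
  the linear term alone is at most \<open>\<bar>\<beta>\<bar> * \<bar>c\<bar>\<close>.\<close>

lemma exp_growth_bound:
  fixes \<beta> \<delta> c :: real
  assumes "\<delta> > 0" "u \<ge> c"
  shows "exp (\<beta> * u - \<delta> * exp u) \<le> exp (\<beta>\<^sup>2 / (2 * \<delta>) + \<bar>\<beta>\<bar> * \<bar>c\<bar>)"
proof -
  have "\<beta> * u - \<delta> * exp u \<le> \<beta>\<^sup>2 / (2 * \<delta>) + \<bar>\<beta>\<bar> * \<bar>c\<bar>"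
  proof (cases "u \<ge> 0")
    case True
    have "u\<^sup>2 / 2 \<le> exp u" using exp_lower_Taylor_quadratic[OF True] True by simp
    then have "\<beta> * u - \<delta> * exp u \<le> \<beta> * u - \<delta> * (u\<^sup>2 / 2)" using assms by simp
    also have "\<dots> = \<beta>\<^sup>2 / (2 * \<delta>) - (\<beta> - \<delta> * u)\<^sup>2 / (2 * \<delta>)"
      using assms by (simp add: power2_eq_square field_simps)
    also have "\<dots> \<le> \<beta>\<^sup>2 / (2 * \<delta>)" using assms by simp
    finally show ?thesis by (smt (verit) mult_nonneg_nonneg)
  next
    case False
    then have "\<beta> * u \<le> \<bar>\<beta>\<bar> * \<bar>c\<bar>"
      using assms by (smt (verit) abs_le_iff abs_mult mult_left_mono)
    moreover have "0 \<le> \<delta> * exp u" "0 \<le> \<beta>\<^sup>2 / (2 * \<delta>)" using assms by simp_all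
    ultimately show ?thesis by linarith
  qed
  then show ?thesis by simp
qed

text \<open>\<open>M\<close> is fixed before \<open>F\<close> and \<open>K\<close>, so one constant
  serves a whole family with the same growth exponents, and the dependence on the index sits in
  \<open>K\<close>.\<close>

lemma hankel_bounded_growth:
  fixes \<beta> \<delta> \<rho> :: real
  assumes "\<delta> > 0"
  obtains M where "0 \<le> M"
    "\<And>F K. 0 \<le> K \<Longrightarrow> continuous_on UNIV F \<Longrightarrow>
       (\<And>l. l \<in> hankel_path \<rho> \<Longrightarrow> norm (F l) \<le> K * exp (\<beta> * Re l - \<delta> * exp (Re l))) \<Longrightarrow>
       hankel_bounded \<rho> F (K * M)"
proof
  \<comment> \<open>Of the \<open>+ 2\<close>, one unit pays for the factor \<open>exp l\<close> of
    d\<lambda>, the other for the \<open>exp (- Re l)\<close> that \<open>hankel_bounded\<close>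
    demands.\<close>
  define M where "M = exp ((\<beta> + 2)\<^sup>2 / (2 * \<delta>) + \<bar>\<beta> + 2\<bar> * \<bar>ln \<rho>\<bar>)"
  show "0 \<le> M" by (simp add: M_def)
  fix F :: "complex \<Rightarrow> complex" and K :: real
  assume K: "0 \<le> K" and cont: "continuous_on UNIV F"
    and F: "\<And>l. l \<in> hankel_path \<rho> \<Longrightarrow> norm (F l) \<le> K * exp (\<beta> * Re l - \<delta> * exp (Re l))"
  show "hankel_bounded \<rho> F (K * M)"
  proof
    fix l assume l: "l \<in> hankel_path \<rho>"
    have "norm (F l * exp l) \<le> K * exp (\<beta> * Re l - \<delta> * exp (Re l)) * exp (Re l)"
      using F[OF l] by (simp add: norm_mult)
    also have "\<dots> = K * exp ((\<beta> + 2) * Re l - \<delta> * exp (Re l)) * exp (- Re l)"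
      by (simp add: mult.assoc algebra_simps flip: exp_add)
    also have "\<dots> \<le> K * M * exp (- Re l)"
      unfolding M_def using exp_growth_bound[OF assms hankel_pathD(1)[OF l], of "\<beta> + 2"] K
      by (intro mult_right_mono mult_left_mono) auto
    finally show "norm (F l * exp l) \<le> K * M * exp (- Re l)" .
  qed (fact cont)
qed

lemma hankel_bounded_exp:
  assumes "\<rho> > 0"
  obtains M where "hankel_bounded \<rho> (\<lambda>l. exp (exp l) * exp (- z * l)) M"
proof -
  obtain M where M: "\<And>F K. 0 \<le> K \<Longrightarrow> continuous_on UNIV F \<Longrightarrow>
       (\<And>l. l \<in> hankel_path \<rho> \<Longrightarrow> norm (F l) \<le> K * exp (- Re z * Re l - 1 * exp (Re l))) \<Longrightarrow>
       hankel_bounded \<rho> F (K * M)"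
    using hankel_bounded_growth[of 1 \<rho> "- Re z", OF zero_less_one] by blast
  have "hankel_bounded \<rho> (\<lambda>l. exp (exp l) * exp (- z * l)) (exp (2 * \<rho> + pi * \<bar>Im z\<bar>) * M)"
  proof (rule M)
    fix l assume l: "l \<in> hankel_path \<rho>"
    have "norm (exp (exp l) * exp (- z * l))
        \<le> exp (2 * \<rho> - exp (Re l)) * (exp (pi * \<bar>Im (- z)\<bar>) * exp (Re (- z) * Re l))"
      unfolding norm_mult
      by (intro mult_mono norm_exp_exp_hankel_path norm_exp_mult_hankel_path[OF l] l assms) auto
    then show "norm (exp (exp l) * exp (- z * l))
        \<le> exp (2 * \<rho> + pi * \<bar>Im z\<bar>) * exp (- Re z * Re l - 1 * exp (Re l))"
      by (simp add: algebra_simps flip: exp_add)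
  qed (auto intro!: continuous_intros)
  then show ?thesis by (rule that)
qed

text \<open>On \<open>Re z < 1\<close> the difference of the primitive across the cut, taken along the whole line
  instead of along the circle, is an Euler integral in the variable \<open>exp u\<close>.\<close>
lemma hankel_rGamma_left:
  assumes "\<rho> > 0" and z: "Re z < 1"
  shows "hankel_integral \<rho> (\<lambda>l. exp (exp l) * exp (- z * l)) = 2 * \<i> * of_real pi * rGamma z"
proof -
  define F where "F = (\<lambda>l. exp (exp l) * exp (- z * l))"
  define c where "c = ln \<rho>"
  obtain M where M: "hankel_bounded \<rho> F M" using hankel_bounded_exp[OF assms(1)] F_def by blast
  have "(\<lambda>l. F l * exp l) holomorphic_on UNIV" unfolding F_def by (intro holomorphic_intros)
  from holomorphic_convex_primitive'[OF _ _ this]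
  obtain P where P: "\<And>l. (P has_field_derivative F l * exp l) (at l)" by auto
  \<comment> \<open>The jump of the primitive across the cut. Along \<open>c + real k\<close> it
    tends to the Hankel integral, along \<open>- real k\<close> to 0, and its derivative is the
    integrand \<open>f\<close> of Gamma (1 - z), in the variable \<open>exp u\<close>, times the
    constant jump \<open>s\<close> of the power.\<close>
  define D where "D u = P (Complex u pi) - P (Complex u (- pi))" for u
  define f where "f t = complex_of_real t powr (1 - z - 1) / of_real (exp t)" for t :: real
  define s where "s = 2 * \<i> * sin (of_real pi * z)"
  have D': "(D has_vector_derivative s * (exp u *\<^sub>R f (exp u))) (at u within A)" for u A
  proof -
    have "((\<lambda>u. Complex u y) has_vector_derivative 1) (at u within A)" for y
      unfolding Complex_eq by (auto intro!: derivative_eq_intros)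
    from field_vector_diff_chain_within[OF this, of P] P
    have 1: "((\<lambda>u. P (Complex u y)) has_vector_derivative F (Complex u y) * exp (Complex u y)) (at u within A)" for y
      by (auto simp: o_def has_field_derivative_at_within)
    have e: "exp (Complex u pi) = - of_real (exp u)" "exp (Complex u (- pi)) = - of_real (exp u)"
      by (simp_all add: complex_eq_iff Re_exp Im_exp)
    have e2: "exp (- z * Complex u y) = exp (- z * of_real u) * exp (- (\<i> * of_real y * z))" for y
      by (simp add: Complex_eq algebra_simps flip: exp_add)
    have f: "exp u *\<^sub>R f (exp u) = of_real (exp u) * (exp (- z * of_real u) * exp (- of_real (exp u)))"
      unfolding f_def
      by (simp add: powr_def Ln_of_real[OF exp_gt_zero] exp_minus divide_inverse scaleR_conv_of_real
          of_real_exp[of "exp u"])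
    have s: "s = exp (\<i> * of_real pi * z) - exp (- (\<i> * of_real pi * z))"
      unfolding s_def sin_exp_eq by (simp add: mult.assoc field_simps)
    have "F (Complex u pi) * exp (Complex u pi) - F (Complex u (- pi)) * exp (Complex u (- pi))
        = s * (exp u *\<^sub>R f (exp u))"
      unfolding f F_def e e2 s by (simp add: algebra_simps)
    with has_vector_derivative_diff[OF 1[of pi] 1[of "- pi"]] show ?thesis unfolding D_def by simp
  qed
  have sub: "D b - D a = s * integral {exp a..exp b} f" if "a \<le> b" for a b
  proof -
    have pos: "0 \<le> x \<and> x \<noteq> 0" if "exp a \<le> x" for x
      using less_le_trans[OF exp_gt_zero that] by simp
    have f1: "((\<lambda>u. s * (exp u *\<^sub>R f (exp u))) has_integral D b - D a) {a..b}"
      using that D' by (rule fundamental_theorem_of_calculus)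
    have "((\<lambda>u. exp u *\<^sub>R f (exp u)) has_integral integral {exp a..exp b} f) {a..b}"
      by (rule has_integral_substitution[where c = "exp a" and d = "exp b"])
         (use that pos in \<open>auto simp: f_def intro!: continuous_intros derivative_eq_intros\<close>)
    from has_integral_unique[OF f1 has_integral_mult_right[OF this]] show ?thesis .
  qed
  have absint: "f absolutely_integrable_on {0<..}"
    unfolding f_def by (rule absolutely_integrable_Gamma_integral') (use z in simp)
  have lim1: "(\<lambda>k. integral {exp (- real k)..exp (c + real k)} f) \<longlonglongrightarrow> integral {0<..} f"
  proof -
    define S where "S k = {exp (- real k)..exp (c + real k)}" for k
    have S: "S k \<subseteq> {0<..}" for k by (auto simp: S_def intro: less_le_trans[OF exp_gt_zero])
    have "(\<lambda>k. integral {0<..} (\<lambda>u. if u \<in> S k then f u else 0)) \<longlonglongrightarrow> integral {0<..} f"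
    proof (rule dominated_convergence(2)[where h = "\<lambda>u. norm (f u)"])
      fix k
      have "f integrable_on S k"
        using set_integrable_subset[OF absint _ S] set_lebesgue_integral_eq_integral(1) by (auto simp: S_def)
      then show "(\<lambda>u. if u \<in> S k then f u else 0) integrable_on {0<..}"
        by (subst integrable_restrict_Int) (simp add: Int_absorb2[OF S] Int_absorb1[OF S])
    next
      fix u :: real assume u: "u \<in> {0<..}"
      have "\<forall>\<^sub>F k in sequentially. (if u \<in> S k then f u else 0) = f u"
        using eventually_ge_at_top[of "nat \<lceil>\<bar>ln u\<bar> + \<bar>c\<bar>\<rceil>"]
      proof eventually_elim
        case (elim k)
        then have "\<bar>ln u\<bar> + \<bar>c\<bar> \<le> real k" by (simp add: nat_le_iff ceiling_le_iff)
        then have "- real k \<le> ln u" "ln u \<le> c + real k" by linarith+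
        then have "exp (- real k) \<le> exp (ln u)" "exp (ln u) \<le> exp (c + real k)"
          by (simp_all only: exp_le_cancel_iff)
        then have "exp (- real k) \<le> u" "u \<le> exp (c + real k)"
          using u by (simp_all only: exp_ln greaterThan_iff)
        then have "u \<in> S k" by (simp add: S_def)
        then show ?case by simp
      qed
      then show "(\<lambda>k. if u \<in> S k then f u else 0) \<longlonglongrightarrow> f u" by (rule tendsto_eventually)
    qed (use absint in \<open>auto simp: absolutely_integrable_on_def\<close>)
    moreover have "integral {0<..} (\<lambda>u. if u \<in> S k then f u else 0) = integral (S k) f" for k
      by (subst integral_restrict_Int) (simp add: Int_absorb2[OF S] Int_absorb1[OF S])
    ultimately show ?thesis by (simp add: S_def)
  qed
  \<comment> \<open>\<open>D (- real k)\<close> is bounded by the length \<open>2 * pi\<close> of a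
    vertical segment times the size of the derivative there. Since |\<lambda>| \<le> 1,
    \<open>exp (exp l)\<close> stays below \<open>exp 1\<close>, and \<open>Re z < 1\<close> makes
    the remaining factor decay geometrically.\<close>
  have lim2: "(\<lambda>k. D (- real k)) \<longlonglongrightarrow> 0"
  proof (rule Lim_null_comparison)
    show "\<forall>\<^sub>F k in sequentially. norm (D (- real k))
        \<le> exp 1 * exp (pi * \<bar>Im z\<bar>) * exp (- (1 - Re z)) ^ k * (2 * pi)"
    proof (rule always_eventually, rule allI)
      fix k
      have "norm (D (- real k)) \<le> exp 1 * exp (pi * \<bar>Im z\<bar>) * exp (- (1 - Re z)) ^ k
              * norm (Complex (- real k) pi - Complex (- real k) (- pi))"
        unfolding D_def
      proof (rule field_differentiable_bound)
        fix l assume "l \<in> closed_segment (Complex (- real k) (- pi)) (Complex (- real k) pi)"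
        then have l: "Re l = - real k" "\<bar>Im l\<bar> \<le> pi"
          by (auto simp: closed_segment_same_Re closed_segment_eq_real_ivl)
        have "Re (exp l) \<le> norm (exp l)" by (rule complex_Re_le_cmod)
        then have 1: "norm (exp (exp l)) \<le> exp 1"
          using l order.trans[of "Re (exp l)" "exp (- real k)" 1] by (simp add: norm_exp_eq_Re)
        have "Im z * Im l \<le> \<bar>Im z\<bar> * \<bar>Im l\<bar>" by (metis abs_ge_self abs_mult)
        also have "\<dots> \<le> \<bar>Im z\<bar> * pi" using l by (intro mult_left_mono) auto
        finally have 2: "norm (exp (- z * l) * exp l) \<le> exp (pi * \<bar>Im z\<bar>) * exp (- (1 - Re z)) ^ k"
          using l by (simp add: norm_mult norm_exp_eq_Re algebra_simps flip: exp_add exp_of_nat_mult)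
        show "norm (F l * exp l) \<le> exp 1 * exp (pi * \<bar>Im z\<bar>) * exp (- (1 - Re z)) ^ k"
          using mult_mono[OF 1 2] by (simp add: F_def norm_mult mult_ac)
      qed (use P in \<open>auto intro: has_field_derivative_at_within\<close>)
      also have "Complex (- real k) pi - Complex (- real k) (- pi) = \<i> * of_real (2 * pi)"
        by (simp add: complex_eq_iff)
      finally show "norm (D (- real k)) \<le> exp 1 * exp (pi * \<bar>Im z\<bar>) * exp (- (1 - Re z)) ^ k * (2 * pi)"
        by (simp add: norm_mult)
    qed
    show "(\<lambda>k. exp 1 * exp (pi * \<bar>Im z\<bar>) * exp (- (1 - Re z)) ^ k * (2 * pi)) \<longlonglongrightarrow> 0"
      using z by (intro tendsto_mult_left_zero tendsto_mult_right_zero LIMSEQ_realpow_zero) auto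
  qed
  have "(\<lambda>k. D (- real k) + s * integral {exp (- real k)..exp (c + real k)} f) \<longlonglongrightarrow> 0 + s * integral {0<..} f"
    by (intro tendsto_intros lim1 lim2)
  moreover have "\<forall>\<^sub>F k in sequentially. D (- real k) + s * integral {exp (- real k)..exp (c + real k)} f = D (c + real k)"
    using eventually_ge_at_top[of "nat \<lceil>\<bar>c\<bar>\<rceil>"]
  proof eventually_elim
    case (elim k)
    then have "\<bar>c\<bar> \<le> real k" by (simp add: nat_le_iff ceiling_le_iff)
    then have "- real k \<le> c + real k" by linarith
    from sub[OF this, symmetric] show ?case by simp
  qed
  ultimately have "(\<lambda>k. D (c + real k)) \<longlonglongrightarrow> s * integral {0<..} f"
    by (simp add: tendsto_cong)
  moreover have "(\<lambda>k. D (c + real k)) \<longlonglongrightarrow> hankel_integral \<rho> F"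
    using hankel_integral_primitive[OF M P] unfolding D_def c_def .
  ultimately have "hankel_integral \<rho> F = s * integral {0<..} f" using LIMSEQ_unique by blast
  also have "integral {0<..} f = Gamma (1 - z)"
    using Gamma_integral_complex'[of "1 - z"] z unfolding f_def by (simp add: integral_unique)
  also have "s * Gamma (1 - z) = 2 * \<i> * of_real pi * rGamma z"
  proof -
    have nz: "1 - z \<notin> \<int>\<^sub>\<le>\<^sub>0" using z by (auto elim!: nonpos_Ints_cases dest!: arg_cong[of _ _ Re])
    then have g: "rGamma (1 - z) * Gamma (1 - z) = 1"
      by (simp add: rGamma_inverse_Gamma Gamma_eq_zero_iff)
    have "rGamma z * rGamma (1 - z) = sin (of_real pi * z) / of_real pi"
      by (rule rGamma_reflection_complex)
    then have "sin (of_real pi * z) = of_real pi * (rGamma z * rGamma (1 - z))" by simp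
    then have "sin (of_real pi * z) * Gamma (1 - z) = of_real pi * rGamma z * (rGamma (1 - z) * Gamma (1 - z))"
      by (simp only: mult_ac)
    then have "sin (of_real pi * z) * Gamma (1 - z) = of_real pi * rGamma z" unfolding g by simp
    then show ?thesis unfolding s_def by (simp add: mult_ac)
  qed
  finally show ?thesis unfolding F_def .
qed

text \<open>The recursion reaches \<open>z\<close> by dividing by \<open>z - 1\<close>, so this
  value needs its own argument. Split exp \<lambda> / \<lambda> into 1 / \<lambda> and the entire
  function (exp \<lambda> - 1) / \<lambda>: a primitive of the latter, evaluated at
  \<open>exp l\<close>, agrees on both edges of the cut, and only the jump of \<open>l\<close>
  survives.\<close>

lemma hankel_rGamma_one:
  assumes "\<rho> > 0"
  shows "hankel_integral \<rho> (\<lambda>l. exp (exp l) * exp (- 1 * l)) = 2 * \<i> * of_real pi"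
proof -
  obtain M where M: "hankel_bounded \<rho> (\<lambda>l. exp (exp l) * exp (- 1 * l)) M"
    using hankel_bounded_exp[OF assms] by blast
  have "(\<lambda>w. if w = 0 then deriv exp 0 else (exp w - exp 0) / (w - 0)) holomorphic_on UNIV"
    by (rule pole_lemma_open) (auto intro!: holomorphic_intros)
  moreover have "deriv exp 0 = (1::complex)"
    using DERIV_imp_deriv[OF DERIV_exp, of "0::complex"] by simp
  ultimately have "(\<lambda>w::complex. if w = 0 then 1 else (exp w - 1) / w) holomorphic_on UNIV"
    by (simp cong: if_cong)
  from holomorphic_convex_primitive'[OF _ _ this]
  obtain Q :: "complex \<Rightarrow> complex" where Q: "\<And>w. (Q has_field_derivative (if w = 0 then 1 else (exp w - 1) / w)) (at w)"
    by auto
  have "((\<lambda>l. l + Q (exp l)) has_field_derivative exp (exp l) * exp (- 1 * l) * exp l) (at l)" for l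
  proof -
    have "((\<lambda>l. Q (exp l)) has_field_derivative (exp (exp l) - 1) / exp l * exp l) (at l)"
      using DERIV_chain2[OF Q[of "exp l"] DERIV_exp] by simp
    from DERIV_add[OF DERIV_ident this] show ?thesis by (simp add: mult.assoc flip: exp_add)
  qed
  from hankel_integral_primitive[OF M this]
  have "(\<lambda>k. Complex (ln \<rho> + real k) pi + Q (exp (Complex (ln \<rho> + real k) pi)) -
         (Complex (ln \<rho> + real k) (- pi) + Q (exp (Complex (ln \<rho> + real k) (- pi)))))
    \<longlonglongrightarrow> hankel_integral \<rho> (\<lambda>l. exp (exp l) * exp (- 1 * l))" .
  moreover have "Complex u pi + Q (exp (Complex u pi)) -
         (Complex u (- pi) + Q (exp (Complex u (- pi)))) = 2 * \<i> * of_real pi" for u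
  proof -
    have "exp (Complex u pi) = exp (Complex u (- pi))" by (simp add: complex_eq_iff Re_exp Im_exp)
    then have "Q (exp (Complex u pi)) = Q (exp (Complex u (- pi)))" by simp
    then show ?thesis by (simp add: complex_eq_iff)
  qed
  ultimately show ?thesis using LIMSEQ_unique[OF _ tendsto_const] by simp
qed

text \<open>Integration by parts: \<open>?F - z * ?G\<close> is the \<lambda>-derivative of exp
  \<lambda> * \<lambda>^(-z), which vanishes in the limit along both rays.\<close>

lemma hankel_rGamma_shift:
  assumes "\<rho> > 0"
  shows "hankel_integral \<rho> (\<lambda>l. exp (exp l) * exp (- z * l))
       = z * hankel_integral \<rho> (\<lambda>l. exp (exp l) * exp (- (z + 1) * l))"
proof -
  let ?F = "\<lambda>l. exp (exp l) * exp (- z * l)" and ?G = "\<lambda>l. exp (exp l) * exp (- (z + 1) * l)"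
  obtain M where M: "hankel_bounded \<rho> ?F M" using hankel_bounded_exp[OF assms] by blast
  obtain N where N: "hankel_bounded \<rho> ?G N" using hankel_bounded_exp[OF assms] by blast
  have MN: "hankel_bounded \<rho> (\<lambda>l. ?F l + - z * ?G l) (M + norm (- z) * N)"
    by (rule hankel_bounded_add(1)[OF M hankel_bounded_cmult[OF N]])
  have "((\<lambda>l. exp (exp l - z * l)) has_field_derivative (?F l + - z * ?G l) * exp l) (at l)" for l
    by (rule derivative_eq_intros refl)+ (simp add: algebra_simps exp_add exp_diff exp_minus field_simps)
  from hankel_integral_primitive[OF MN this]
  have 1: "(\<lambda>k. exp (exp (Complex (ln \<rho> + real k) pi) - z * Complex (ln \<rho> + real k) pi) -
         exp (exp (Complex (ln \<rho> + real k) (- pi)) - z * Complex (ln \<rho> + real k) (- pi)))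
    \<longlonglongrightarrow> hankel_integral \<rho> (\<lambda>l. ?F l + - z * ?G l)" .
  have lim: "(\<lambda>k. exp (exp (Complex (ln \<rho> + real k) y) - z * Complex (ln \<rho> + real k) y)) \<longlonglongrightarrow> 0"
    if y: "y = pi \<or> y = - pi" for y
  proof (rule Lim_null_comparison)
    define C where "C = exp ((- Re z + 1)\<^sup>2 / 2 + \<bar>- Re z + 1\<bar> * \<bar>ln \<rho>\<bar>)"
    show "\<forall>\<^sub>F k in sequentially. norm (exp (exp (Complex (ln \<rho> + real k) y) - z * Complex (ln \<rho> + real k) y))
            \<le> (C * exp (Im z * y) * exp (- ln \<rho>)) * exp (- 1) ^ k"
    proof (rule always_eventually, rule allI)
      fix k
      define u where "u = ln \<rho> + real k"
      have "norm (exp (exp (Complex u y) - z * Complex u y)) = exp ((- Re z + 1) * u - 1 * exp u) * exp (Im z * y) * exp (- u)"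
        using y by (auto simp: norm_exp_eq_Re Re_exp algebra_simps simp flip: exp_add)
      also have "\<dots> \<le> C * exp (Im z * y) * exp (- u)"
        unfolding C_def using exp_growth_bound[of 1 "ln \<rho>" u "- Re z + 1"]
        by (intro mult_right_mono) (auto simp: u_def)
      also have "\<dots> = (C * exp (Im z * y) * exp (- ln \<rho>)) * exp (- 1) ^ k"
        by (simp add: u_def exp_diff exp_minus field_simps exp_add flip: exp_of_nat_mult)
      finally show "norm (exp (exp (Complex (ln \<rho> + real k) y) - z * Complex (ln \<rho> + real k) y))
            \<le> (C * exp (Im z * y) * exp (- ln \<rho>)) * exp (- 1) ^ k" unfolding u_def .
    qed
    show "(\<lambda>k. (C * exp (Im z * y) * exp (- ln \<rho>)) * exp (- 1) ^ k) \<longlonglongrightarrow> 0"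
      by (intro tendsto_mult_right_zero LIMSEQ_realpow_zero) auto
  qed
  have "hankel_integral \<rho> (\<lambda>l. ?F l + - z * ?G l) = 0"
    using LIMSEQ_unique[OF 1 tendsto_diff[OF lim[of pi] lim[of "- pi"]]] by simp
  then show ?thesis
    using hankel_bounded_add(2)[OF M hankel_bounded_cmult[OF N], of "- z"] hankel_integral_cmult[of \<rho> "- z" ?G] by simp
qed

text \<open>The half plane \<open>Re z < 1\<close> is extended to the right by one unit at a time,
  since \<open>rGamma\<close> obeys the same shift relation as the integral.\<close>

theorem hankel_rGamma:
  assumes "\<rho> > 0"
  shows "hankel_integral \<rho> (\<lambda>l. exp (exp l) * exp (- z * l)) = 2 * \<i> * of_real pi * rGamma z"
proof -
  have "hankel_integral \<rho> (\<lambda>l. exp (exp l) * exp (- z * l)) = 2 * \<i> * of_real pi * rGamma z"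
    if "Re z < real n + 1" for n
    using that
  proof (induction n arbitrary: z)
    case 0
    then show ?case using hankel_rGamma_left[OF assms] by simp
  next
    case (Suc n)
    show ?case
    proof (cases "z = 1")
      case True
      then show ?thesis using hankel_rGamma_one[OF assms] by simp
    next
      case False
      have "(z - 1) * hankel_integral \<rho> (\<lambda>l. exp (exp l) * exp (- z * l))
          = 2 * \<i> * of_real pi * rGamma (z - 1)"
        using hankel_rGamma_shift[OF assms, of "z - 1"] Suc.IH[of "z - 1"] Suc.prems by simp
      also have "\<dots> = (z - 1) * (2 * \<i> * of_real pi * rGamma z)"
        using rGamma_plus1[of "z - 1"] by simp
      finally show ?thesis using False by simp
    qed
  qed
  from this[of "nat \<lceil>Re z\<rceil>"] show ?thesis by linarith
qed

subsection \<open>Bessel series\<close>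

text \<open>The coefficient of z^(\<mu> + 2k) in the classical \<open>J\<^sub>\<mu>(z)\<close>; the
  difference Bessel function replaces this power by \<open>gen_fall\<close>.\<close>

definition bessel_coeff :: "complex \<Rightarrow> nat \<Rightarrow> complex" where
  "bessel_coeff \<mu> k = (-1) ^ k / (2 powr (\<mu> + 2 * of_nat k) * fact k) * rGamma (\<mu> + of_nat k + 1)"

lemma dBessel_term_eq:
  "dBessel_term \<mu> x k = Gamma (x + 1) * (bessel_coeff \<mu> k * rGamma (x + 1 - (\<mu> + 2 * of_nat k)))"
  by (simp add: dBessel_term_def bessel_coeff_def gen_fall_def)

lemma two_powr_add_one: "(2::complex) powr (z + 1) = 2 * 2 powr z"
  by (simp add: powr_add)

text \<open>Solved for the lower coefficient, because \<open>\<mu> + of_nat k + 1\<close> may vanish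
  and the forward ratio need not exist.\<close>

lemma bessel_coeff_Suc:
  "bessel_coeff \<mu> k = - 4 * of_nat (Suc k) * (\<mu> + of_nat k + 1) * bessel_coeff \<mu> (Suc k)"
proof -
  have 1: "rGamma (\<mu> + of_nat k + 1) = (\<mu> + of_nat k + 1) * rGamma (\<mu> + of_nat (Suc k) + 1)"
    using rGamma_plus1[of "\<mu> + of_nat k + 1"] by (simp add: add_ac)
  have 2: "(2::complex) powr (\<mu> + 2 * of_nat (Suc k)) = 4 * 2 powr (\<mu> + 2 * of_nat k)"
    using two_powr_add_one[of "\<mu> + 2 * of_nat k + 1"] two_powr_add_one[of "\<mu> + 2 * of_nat k"]
    by (simp add: algebra_simps)
  show ?thesis
    unfolding bessel_coeff_def 1 2 by (simp add: field_simps del: of_nat_Suc)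
qed

lemma bessel_coeff_plus_one:
  "bessel_coeff (\<mu> + 1) k = - 2 * of_nat (Suc k) * bessel_coeff \<mu> (Suc k)"
proof -
  have 2: "(2::complex) powr (\<mu> + 2 * of_nat (Suc k)) = 2 * 2 powr (\<mu> + 1 + 2 * of_nat k)"
    using two_powr_add_one[of "\<mu> + 2 * of_nat k + 1"]
    by (simp add: algebra_simps)
  have 3: "\<mu> + 1 + of_nat k + 1 = \<mu> + of_nat (Suc k) + 1" by simp
  show ?thesis
    unfolding bessel_coeff_def 2 3 by (simp add: field_simps del: of_nat_Suc)
qed

lemma bessel_coeff_minus_one:
  "bessel_coeff (\<mu> - 1) k = 2 * (\<mu> + of_nat k) * bessel_coeff \<mu> k"
proof -
  have 1: "rGamma (\<mu> + of_nat k) = (\<mu> + of_nat k) * rGamma (\<mu> + of_nat k + 1)"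
    using rGamma_plus1[of "\<mu> + of_nat k"] by simp
  have 2: "(2::complex) powr (\<mu> + 2 * of_nat k) = 2 * 2 powr (\<mu> - 1 + 2 * of_nat k)"
    using two_powr_add_one[of "\<mu> - 1 + 2 * of_nat k"]
    by (simp add: algebra_simps)
  have 3: "\<mu> - 1 + of_nat k + 1 = \<mu> + of_nat k" by simp
  show ?thesis
    unfolding bessel_coeff_def 2 3 unfolding 1 by (simp add: field_simps)
qed

text \<open>Consecutive values have ratio q (2k + 1) / (2 |\<mu> + k + 1|), which tends to q < 1;
  the ratio test with \<open>c\<close> halfway between q and 1 makes the sequence summable, hence
  bounded.\<close>

lemma bessel_coeff_fact_bound:
  assumes q: "0 < q" "q < (1::real)"
  obtains C where "0 \<le> C" "\<And>k. norm (bessel_coeff \<mu> k) * fact (2 * k) * q ^ k \<le> C"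
proof -
  define f where "f k = norm (bessel_coeff \<mu> k) * fact (2 * k) * q ^ k" for k
  define c where "c = (1 + q) / 2"
  \<comment> \<open>From this index on, \<open>1 + 2 * norm \<mu> \<le> (1 - q) * real k\<close>,
    just enough for
    \<open>q * (2 * real k + 1) \<le> 2 * c * (real k + 1 - norm \<mu>)\<close>.\<close>
  obtain N :: nat where N: "(1 + 2 * norm \<mu>) / (1 - q) \<le> real N" using real_arch_simple by blast
  have "summable f"
  proof (rule summable_ratio_test)
    show "c < 1" using q by (simp add: c_def)
    fix k assume "k \<ge> N"
    then have "(1 + 2 * norm \<mu>) / (1 - q) \<le> real k" using N by linarith
    then have k: "1 + 2 * norm \<mu> \<le> (1 - q) * real k" using q by (simp add: field_simps)
    define d where "d = norm (\<mu> + of_nat k + 1)"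
    have "real k + 1 - norm \<mu> \<le> d"
      using norm_triangle_ineq4[of "\<mu> + of_nat k + 1" \<mu>] norm_of_nat[of "Suc k", where 'a = complex]
      unfolding d_def by (simp add: add_ac)
    then have "2 * c * (real k + 1 - norm \<mu>) \<le> 2 * c * d"
      using q by (intro mult_left_mono) (auto simp: c_def)
    moreover have "q * (2 * real k + 1) \<le> 2 * c * (real k + 1 - norm \<mu>)"
    proof -
      have "q * norm \<mu> \<le> 1 * norm \<mu>" using q by (intro mult_right_mono) auto
      with k q show ?thesis by (simp add: c_def algebra_simps)
    qed
    ultimately have cd: "q * (2 * real k + 1) \<le> 2 * c * d" by simp
    have "(1 - q) * real k \<le> 1 * real k" using q by (intro mult_right_mono) auto
    with k \<open>real k + 1 - norm \<mu> \<le> d\<close> have d: "d > 0" using norm_ge_zero[of \<mu>] by linarith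
    have "f k = 4 * real (Suc k) * d * norm (bessel_coeff \<mu> (Suc k)) * fact (2 * k) * q ^ k"
      unfolding f_def d_def by (subst bessel_coeff_Suc) (simp add: norm_mult del: of_nat_Suc)
    moreover have "f (Suc k) = norm (bessel_coeff \<mu> (Suc k)) * (2 * real (Suc k) * (2 * real k + 1) * fact (2 * k)) * (q * q ^ k)"
      unfolding f_def by (simp add: algebra_simps)
    ultimately have "2 * d * f (Suc k) = q * (2 * real k + 1) * f k" by (simp add: mult_ac)
    also have "\<dots> \<le> 2 * c * d * f k" using cd q by (intro mult_right_mono) (auto simp: f_def)
    finally have "d * f (Suc k) \<le> d * (c * f k)" by (simp add: mult_ac)
    then have "f (Suc k) \<le> c * f k" using d by simp
    moreover have "f k \<ge> 0" "f (Suc k) \<ge> 0" using q by (auto simp: f_def)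
    ultimately show "norm (f (Suc k)) \<le> c * norm (f k)" by simp
  qed
  then have "Bseq f" by (intro convergent_imp_Bseq) (auto intro: summable_LIMSEQ_zero simp: convergent_def)
  then obtain C where "C > 0" "\<And>k. norm (f k) \<le> C" by (auto simp: Bseq_def)
  then show ?thesis by (intro that[of C]) (auto simp: f_def dest: spec intro: order.trans[OF abs_ge_self])
qed

text \<open>The power (a r)^(2k) is split in three: \<open>q ^ k\<close> pays for
  \<open>bessel_coeff_fact_bound\<close>, \<open>\<theta> ^ k\<close> is kept for summability, and
  (s r)^(2k) / (2k)! is a single term of the exponential series. Choosing \<open>a < q < 1\<close>
  makes both \<theta> and s smaller than 1.\<close>

lemma bessel_coeff_bound:
  assumes a: "0 \<le> a" "a < (1::real)"
  obtains C \<theta> s where "0 \<le> C" "0 \<le> \<theta>" "\<theta> < 1" "0 < s" "s < 1"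
    "\<And>k r. r \<ge> 0 \<Longrightarrow> norm (bessel_coeff \<mu> k) * (a * r) ^ (2 * k) \<le> C * \<theta> ^ k * exp (s * r)"
proof -
  define q where "q = (1 + a) / 2"
  have q: "0 < q" "q < 1" "a < q" using a by (auto simp: q_def)
  obtain C where C: "0 \<le> C" "\<And>k. norm (bessel_coeff \<mu> k) * fact (2 * k) * q ^ k \<le> C"
    using bessel_coeff_fact_bound[OF q(1,2)] by metis
  define s where "s = sqrt q"
  have s: "0 < s" "s < 1" "s\<^sup>2 = q" using q by (auto simp: s_def)
  define \<theta> where "\<theta> = (a / q)\<^sup>2"
  have "norm (bessel_coeff \<mu> k) * (a * r) ^ (2 * k) \<le> C * \<theta> ^ k * exp (s * r)" if "r \<ge> 0" for k r
  proof -
    have "(s * r) ^ (2 * k) / fact (2 * k) \<le> exp (s * r)"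
    proof -
      have "(\<Sum>n\<in>{2 * k}. (s * r) ^ n /\<^sub>R fact n) \<le> (\<Sum>n. (s * r) ^ n /\<^sub>R fact n)"
        using s that by (intro sum_le_suminf summable_exp_generic) auto
      then show ?thesis by (simp add: exp_def divide_inverse mult.commute)
    qed
    then have 1: "(s * r) ^ (2 * k) \<le> fact (2 * k) * exp (s * r)" by (simp add: field_simps)
    have "(a * r)\<^sup>2 = \<theta> * q * (s * r)\<^sup>2"
      unfolding \<theta>_def power_mult_distrib s(3) using q by (simp add: power2_eq_square)
    then have "(a * r) ^ (2 * k) = \<theta> ^ k * q ^ k * (s * r) ^ (2 * k)"
      by (simp only: power_mult power_mult_distrib[of _ _ k])
    then have "norm (bessel_coeff \<mu> k) * (a * r) ^ (2 * k)
        = norm (bessel_coeff \<mu> k) * \<theta> ^ k * q ^ k * (s * r) ^ (2 * k)" by simp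
    also have "\<dots> \<le> norm (bessel_coeff \<mu> k) * \<theta> ^ k * q ^ k * (fact (2 * k) * exp (s * r))"
      using q by (intro mult_left_mono[OF 1]) (auto simp: \<theta>_def)
    also have "\<dots> = (norm (bessel_coeff \<mu> k) * fact (2 * k) * q ^ k) * (\<theta> ^ k * exp (s * r))" by simp
    also have "\<dots> \<le> C * (\<theta> ^ k * exp (s * r))"
      by (intro mult_right_mono C) (auto simp: \<theta>_def)
    finally show ?thesis by simp
  qed
  moreover have "\<theta> < 1" "0 \<le> \<theta>" using q a by (auto simp: \<theta>_def power_less_one_iff)
  ultimately show ?thesis using that C(1) s by blast
qed

text \<open>\<open>bessel_Phi \<mu> (z\<^sup>2) = z powr (- \<mu>) * J\<^sub>\<mu>(z)\<close>, with \<open>J\<^sub>\<mu>\<close> the classical Bessel function.\<close>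
definition bessel_Phi :: "complex \<Rightarrow> complex \<Rightarrow> complex" where
  "bessel_Phi \<mu> w = (\<Sum>k. bessel_coeff \<mu> k * w ^ k)"

lemma summable_bessel_coeff: "summable (\<lambda>k. bessel_coeff \<mu> k * w ^ k)"
proof -
  \<comment> \<open>Any \<open>a\<close> strictly between 0 and 1 serves;
    \<open>r = 2 * sqrt (norm w)\<close> below then gives
    \<open>(a * r) ^ (2 * k) = norm w ^ k\<close>.\<close>
  obtain C \<theta> s where *: "0 \<le> C" "0 \<le> \<theta>" "\<theta> < 1"
    "\<And>k r. r \<ge> 0 \<Longrightarrow> norm (bessel_coeff \<mu> k) * (1 / 2 * r) ^ (2 * k) \<le> C * \<theta> ^ k * exp (s * r)"
    by (rule bessel_coeff_bound[of "1 / 2" \<mu>]) auto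
  show ?thesis
  proof (rule summable_comparison_test'[where N = 0])
    show "summable (\<lambda>k. C * \<theta> ^ k * exp (s * (2 * sqrt (norm w))))"
      using * by (intro summable_mult summable_mult2 summable_geometric) auto
    show "norm (bessel_coeff \<mu> k * w ^ k) \<le> C * \<theta> ^ k * exp (s * (2 * sqrt (norm w)))" for k
      using *(4)[of "2 * sqrt (norm w)" k] by (simp add: norm_mult norm_power power_mult)
  qed
qed

lemma bessel_Phi_sums: "(\<lambda>k. bessel_coeff \<mu> k * w ^ k) sums bessel_Phi \<mu> w"
  unfolding bessel_Phi_def by (rule summable_sums[OF summable_bessel_coeff])

text \<open>The classical rule that z^(-\<mu>) J_\<mu>(z) has derivative - z^(-\<mu>)
  J_(\<mu>+1)(z), in the variable w = z^2. It drives the cosine family, whose index rises.\<close>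

lemma DERIV_bessel_Phi: "(bessel_Phi \<mu> has_field_derivative - bessel_Phi (\<mu> + 1) w / 2) (at w)"
proof -
  have "(\<lambda>k. diffs (bessel_coeff \<mu>) k * w ^ k) = (\<lambda>k. (- 1 / 2) * (bessel_coeff (\<mu> + 1) k * w ^ k))"
    unfolding diffs_def bessel_coeff_plus_one by (simp add: mult.assoc del: of_nat_Suc)
  then have "(\<Sum>k. diffs (bessel_coeff \<mu>) k * w ^ k) = - bessel_Phi (\<mu> + 1) w / 2"
    using suminf_mult[OF summable_bessel_coeff, of "- 1 / 2" "\<mu> + 1" w] by (simp add: bessel_Phi_def)
  with termdiffs_strong_converges_everywhere[OF summable_bessel_coeff, of \<mu> w]
  show ?thesis by (simp add: bessel_Phi_def[abs_def])
qed

lemma continuous_on_bessel_Phi [continuous_intros]: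
  "continuous_on A f \<Longrightarrow> continuous_on A (\<lambda>x. bessel_Phi \<mu> (f x))"
  by (rule continuous_on_compose2[of UNIV "bessel_Phi \<mu>"])
     (auto intro: continuous_at_imp_continuous_on DERIV_isCont[OF DERIV_bessel_Phi])

text \<open>The three-term recurrence (2 \<mu> / z) J_\<mu> = J_(\<mu>-1) + J_(\<mu>+1), with w =
  z^2. Combined with the derivative it lowers the index, as the sine family requires.\<close>

lemma bessel_Phi_recurrence:
  "\<mu> * bessel_Phi \<mu> w - w * bessel_Phi (\<mu> + 1) w / 2 = bessel_Phi (\<mu> - 1) w / 2"
proof -
  have "(\<lambda>k. of_nat (Suc k) * bessel_coeff \<mu> (Suc k) * w ^ Suc k) sums (- w / 2 * bessel_Phi (\<mu> + 1) w)"
  proof -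
    have "(\<lambda>k. - w / 2 * (bessel_coeff (\<mu> + 1) k * w ^ k)) sums (- w / 2 * bessel_Phi (\<mu> + 1) w)"
      by (intro sums_mult bessel_Phi_sums)
    moreover have "- w / 2 * (bessel_coeff (\<mu> + 1) k * w ^ k) = of_nat (Suc k) * bessel_coeff \<mu> (Suc k) * w ^ Suc k" for k
      unfolding bessel_coeff_plus_one by (simp del: of_nat_Suc)
    ultimately show ?thesis by (simp only:)
  qed
  from sums_Suc[OF this] have "(\<lambda>k. of_nat k * bessel_coeff \<mu> k * w ^ k) sums (- w / 2 * bessel_Phi (\<mu> + 1) w)" by simp
  from sums_add[OF sums_mult[OF bessel_Phi_sums, of \<mu> \<mu> w] this]
  have "(\<lambda>k. \<mu> * (bessel_coeff \<mu> k * w ^ k) + of_nat k * bessel_coeff \<mu> k * w ^ k)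
    sums (\<mu> * bessel_Phi \<mu> w + - w / 2 * bessel_Phi (\<mu> + 1) w)" .
  moreover have "\<mu> * (bessel_coeff \<mu> k * w ^ k) + of_nat k * bessel_coeff \<mu> k * w ^ k
      = 1 / 2 * (bessel_coeff (\<mu> - 1) k * w ^ k)" for k
    unfolding bessel_coeff_minus_one by (simp add: algebra_simps)
  ultimately have 1: "(\<lambda>k. 1 / 2 * (bessel_coeff (\<mu> - 1) k * w ^ k))
      sums (\<mu> * bessel_Phi \<mu> w + - w / 2 * bessel_Phi (\<mu> + 1) w)"
    by (simp only:)
  have "(\<lambda>k. 1 / 2 * (bessel_coeff (\<mu> - 1) k * w ^ k)) sums (1 / 2 * bessel_Phi (\<mu> - 1) w)"
    by (intro sums_mult bessel_Phi_sums)
  from sums_unique2[OF this 1] show ?thesis by simp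
qed

text \<open>The coefficient form of J_(-1/2)(z) = sqrt (2 / (pi z)) cos z. The recurrence factor 4
  (k + 1) (k + 1/2) is (2k + 1) (2k + 2), the quotient of consecutive even factorials.\<close>

lemma bessel_coeff_neg_half:
  "of_real (sqrt (pi / 2)) * bessel_coeff (- 1 / 2) k = (- 1) ^ k / fact (2 * k)"
proof (induction k)
  case 0
  have "(2::complex) powr (- 1 / 2) = of_real (2 powr (- 1 / 2))"
    by (subst powr_of_real[symmetric]) auto
  also have "(2::real) powr (- 1 / 2) = 1 / sqrt 2"
    by (simp add: powr_minus powr_half_sqrt inverse_eq_divide)
  finally have "(2::complex) powr (- 1 / 2) = 1 / of_real (sqrt 2)" by simp
  moreover have "rGamma (1 / 2 :: complex) = 1 / of_real (sqrt pi)"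
    by (simp add: rGamma_inverse_Gamma Gamma_one_half_complex inverse_eq_divide)
  ultimately show ?case by (simp add: bessel_coeff_def real_sqrt_divide)
next
  case (Suc k)
  define A :: complex where "A = of_nat (Suc (2 * k)) * of_nat (Suc (Suc (2 * k)))"
  define c where "c = of_real (sqrt (pi / 2)) * bessel_coeff (- 1 / 2) (Suc k)"
  have A: "A \<noteq> 0" unfolding A_def by (simp del: of_nat_Suc)
  have "- 4 * of_nat (Suc k) * (- 1 / 2 + of_nat k + 1) = - A"
    by (simp add: A_def algebra_simps)
  then have "bessel_coeff (- 1 / 2) k = - A * bessel_coeff (- 1 / 2) (Suc k)"
    using bessel_coeff_Suc[of "- 1 / 2" k] by (simp only:)
  then have "- A * c = (- 1) ^ k / fact (2 * k)"
    using Suc by (simp add: c_def mult.left_commute)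
  moreover have "c = (- A * c) / (- A)" using A by simp
  ultimately have "c = - ((- 1) ^ k / fact (2 * k)) / A" by simp
  moreover have "fact (2 * Suc k) = A * fact (2 * k)"
    by (simp add: A_def algebra_simps)
  ultimately show ?case by (simp add: c_def)
qed

lemma bessel_coeff_half:
  "of_real (sqrt (pi / 2)) * bessel_coeff (1 / 2) k = (- 1) ^ k / fact (2 * k + 1)"
proof -
  have "bessel_coeff (- 1 / 2) k = 2 * (1 / 2 + of_nat k) * bessel_coeff (1 / 2) k"
    using bessel_coeff_minus_one[of "1 / 2" k] by simp
  then have "of_nat (Suc (2 * k)) * (of_real (sqrt (pi / 2)) * bessel_coeff (1 / 2) k) = (- 1) ^ k / fact (2 * k)"
    using bessel_coeff_neg_half[of k] by (simp add: algebra_simps)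
  then show ?thesis by (simp add: field_simps del: of_nat_Suc)
qed

lemma cos_eq_bessel_Phi: "cos z = of_real (sqrt (pi / 2)) * bessel_Phi (- 1 / 2) (z\<^sup>2)"
proof -
  have "(\<lambda>k. of_real (sqrt (pi / 2)) * (bessel_coeff (- 1 / 2) k * (z\<^sup>2) ^ k))
      sums (of_real (sqrt (pi / 2)) * bessel_Phi (- 1 / 2) (z\<^sup>2))"
    by (intro sums_mult bessel_Phi_sums)
  then have 1: "(\<lambda>k. (- 1) ^ k / fact (2 * k) * z ^ (2 * k)) sums (of_real (sqrt (pi / 2)) * bessel_Phi (- 1 / 2) (z\<^sup>2))"
    by (simp only: mult.assoc[symmetric] bessel_coeff_neg_half power_mult)
  have "(\<lambda>k. cos_coeff (2 * k) *\<^sub>R z ^ (2 * k)) sums cos z"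
    using cos_converges[of z]
    by (subst sums_mono_reindex[of "\<lambda>k. 2 * k" "\<lambda>n. cos_coeff n *\<^sub>R z ^ n"])
       (auto simp: strict_mono_def cos_coeff_def elim!: evenE)
  then have "(\<lambda>k. (- 1) ^ k / fact (2 * k) * z ^ (2 * k)) sums cos z"
    by (simp add: cos_coeff_def scaleR_conv_of_real)
  from sums_unique2[OF this 1] show ?thesis .
qed

lemma sin_eq_bessel_Phi: "sin z = z * of_real (sqrt (pi / 2)) * bessel_Phi (1 / 2) (z\<^sup>2)"
proof -
  have "(\<lambda>k. z * of_real (sqrt (pi / 2)) * (bessel_coeff (1 / 2) k * (z\<^sup>2) ^ k))
      sums (z * of_real (sqrt (pi / 2)) * bessel_Phi (1 / 2) (z\<^sup>2))"
    by (intro sums_mult bessel_Phi_sums)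
  moreover have "z * of_real (sqrt (pi / 2)) * (bessel_coeff (1 / 2) k * (z\<^sup>2) ^ k)
      = (- 1) ^ k / fact (2 * k + 1) * z ^ (2 * k + 1)" for k
  proof -
    have "z * of_real (sqrt (pi / 2)) * (bessel_coeff (1 / 2) k * (z\<^sup>2) ^ k)
      = (of_real (sqrt (pi / 2)) * bessel_coeff (1 / 2) k) * (z * (z\<^sup>2) ^ k)" by (simp only: mult_ac)
    then show ?thesis unfolding bessel_coeff_half by (simp add: power_mult del: fact_Suc)
  qed
  ultimately have 1: "(\<lambda>k. (- 1) ^ k / fact (2 * k + 1) * z ^ (2 * k + 1)) sums (z * of_real (sqrt (pi / 2)) * bessel_Phi (1 / 2) (z\<^sup>2))"
    by simp
  have "(\<lambda>k. sin_coeff (2 * k + 1) *\<^sub>R z ^ (2 * k + 1)) sums sin z"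
    using sin_converges[of z]
    by (subst sums_mono_reindex[of "\<lambda>k. 2 * k + 1" "\<lambda>n. sin_coeff n *\<^sub>R z ^ n"])
       (auto simp: strict_mono_def sin_coeff_def image_def elim!: oddE)
  then have "(\<lambda>k. (- 1) ^ k / fact (2 * k + 1) * z ^ (2 * k + 1)) sums sin z"
    by (simp add: sin_coeff_def scaleR_conv_of_real del: fact_Suc power_Suc)
  from sums_unique2[OF this 1] show ?thesis .
qed

subsection \<open>Difference Bessel functions as Hankel integrals\<close>

text \<open>Summation by parts with the tails \<open>t k\<close>: since
  \<open>c k = t k - t (Suc k)\<close>, the power series at y equals \<open>t 0\<close> minus (1 -
  y) times the power series of the shifted tails. The latter product vanishes as y tends to 1
  because the tails tend to 0.\<close>

lemma abel_limit:
  fixes c :: "nat \<Rightarrow> complex" and y :: "nat \<Rightarrow> real"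
  assumes c: "summable c" and y: "\<And>n. 0 \<le> y n" "\<And>n. y n < 1" "y \<longlonglongrightarrow> 1"
    and g: "\<And>n. (\<lambda>k. c k * of_real (y n) ^ k) sums g n"
  shows "g \<longlonglongrightarrow> suminf c"
proof -
  define t where "t k = (\<Sum>i. c (i + k))" for k
  have t_Suc: "c k = t k - t (Suc k)" for k
  proof -
    have "summable (\<lambda>i. c (i + k))" using c by (simp add: summable_iff_shift)
    from suminf_split_head[OF this] show ?thesis by (simp add: t_def)
  qed
  have t0: "t \<longlonglongrightarrow> 0"
    unfolding t_def by (rule suminf_exist_split2[OF c])
  then obtain B where B: "B > 0" "\<And>k. norm (t k) \<le> B"
    using BseqE[OF convergent_imp_Bseq[OF convergentI[OF t0]]] by blast
  define T where "T n = (\<Sum>k. t (Suc k) * of_real (y n) ^ k)" for n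
  have sum_ty: "summable (\<lambda>k. norm (t (Suc k)) * y n ^ k)" for n
  proof (rule summable_comparison_test')
    show "summable (\<lambda>k. B * y n ^ k)" using y by (intro summable_mult summable_geometric) simp
    show "norm (norm (t (Suc k)) * y n ^ k) \<le> B * y n ^ k" for k
      using mult_right_mono[OF B(2)[of "Suc k"], of "y n ^ k"] y(1)[of n] by simp
  qed
  have T: "(\<lambda>k. t (Suc k) * of_real (y n) ^ k) sums T n" for n
    unfolding T_def
    by (rule summable_sums, rule summable_norm_cancel) (use sum_ty y in \<open>simp add: norm_mult norm_power\<close>)
  have g_eq: "g n = t 0 - (1 - of_real (y n)) * T n" for n
  proof -
    have "(\<lambda>k. t (Suc k) * of_real (y n) ^ Suc k) sums (of_real (y n) * T n)"
      using sums_mult[OF T[of n], of "of_real (y n)"] by (simp add: mult_ac)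
    from sums_Suc[OF this] have "(\<lambda>k. t k * of_real (y n) ^ k) sums (of_real (y n) * T n + t 0)" by simp
    from sums_diff[OF this T[of n]]
    have "(\<lambda>k. c k * of_real (y n) ^ k) sums (of_real (y n) * T n + t 0 - T n)"
      by (simp add: t_Suc algebra_simps)
    from sums_unique2[OF g this] show ?thesis by (simp add: algebra_simps)
  qed
  have "(\<lambda>n. (1 - of_real (y n)) * T n) \<longlonglongrightarrow> 0"
  proof (rule LIMSEQ_I)
    fix e :: real assume e: "e > 0"
    from LIMSEQ_D[OF t0, of "e / 2"] e
    obtain N where N: "\<And>k. k \<ge> N \<Longrightarrow> norm (t k) < e / 2" by auto
    have "(\<lambda>n. (1 - y n) * (real N * B)) \<longlonglongrightarrow> (1 - 1) * (real N * B)"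
      by (intro tendsto_intros y)
    then have "(\<lambda>n. (1 - y n) * (real N * B)) \<longlonglongrightarrow> 0" by simp
    from LIMSEQ_D[OF this, of "e / 2"] e
    obtain M where M: "\<And>n. n \<ge> M \<Longrightarrow> norm ((1 - y n) * (real N * B)) < e / 2" by auto
    have "norm ((1 - of_real (y n)) * T n - 0) < e" if "n \<ge> M" for n
    proof -
      have "norm (T n) \<le> (\<Sum>k. norm (t (Suc k)) * y n ^ k)"
        unfolding T_def using summable_norm[of "\<lambda>k. t (Suc k) * of_real (y n) ^ k"] sum_ty[of n] y
        by (simp add: norm_mult norm_power)
      \<comment> \<open>The first \<open>N\<close> tails cost at most \<open>B\<close> each, the
        later ones at most \<open>e / 2\<close>; the geometric sum \<open>1 / (1 - y n)\<close> of
        the latter is cancelled by the factor in front of \<open>T n\<close>.\<close>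
      also have "\<dots> \<le> (\<Sum>k. (if k \<in> {..<N} then B else 0) + e / 2 * y n ^ k)"
      proof (rule suminf_le[OF _ sum_ty])
        show "summable (\<lambda>k. (if k \<in> {..<N} then B else 0) + e / 2 * y n ^ k)"
          using y by (intro summable_add summable_mult summable_geometric summable_If_finite_set) auto
        fix k
        have p: "0 \<le> y n ^ k" "y n ^ k \<le> 1"
          using y(1)[of n] less_imp_le[OF y(2)[of n]] by (auto intro: power_le_one)
        show "norm (t (Suc k)) * y n ^ k \<le> (if k \<in> {..<N} then B else 0) + e / 2 * y n ^ k"
        proof (cases "k < N")
          case True
          have "norm (t (Suc k)) * y n ^ k \<le> B * 1"
            using B(1) by (intro mult_mono B(2) p) simp_all
          moreover have "0 \<le> e / 2 * y n ^ k" using e p by simp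
          ultimately show ?thesis using True by simp
        next
          case False
          then have "norm (t (Suc k)) \<le> e / 2" using N[of "Suc k"] by simp
          from mult_right_mono[OF this p(1)] show ?thesis using False by simp
        qed
      qed
      also have "\<dots> = real N * B + e / 2 * (1 / (1 - y n))"
      proof (rule sums_unique[symmetric], intro sums_add sums_mult)
        show "(\<lambda>k. if k \<in> {..<N} then B else 0) sums (real N * B)"
          using sums_If_finite_set[OF finite_lessThan[of N], where f = "\<lambda>k. B"] by simp
        show "(\<lambda>k. y n ^ k) sums (1 / (1 - y n))" using y by (intro geometric_sums) auto
      qed
      finally have *: "norm (T n) \<le> real N * B + e / 2 * (1 / (1 - y n))" .
      have "norm ((1 - of_real (y n)) * T n - 0) = (1 - y n) * norm (T n)"
        using y(2)[of n] norm_of_real[of "1 - y n", where 'a = complex] by (simp add: norm_mult)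
      also have "\<dots> \<le> (1 - y n) * (real N * B + e / 2 * (1 / (1 - y n)))"
        using y(2)[of n] by (intro mult_left_mono *) auto
      also have "\<dots> = (1 - y n) * (real N * B) + e / 2" using y(2)[of n] by (simp add: field_simps)
      also have "\<dots> < e" using M[OF that] by (simp add: abs_less_iff)
      finally show ?thesis .
    qed
    then show "\<exists>M. \<forall>n\<ge>M. norm ((1 - of_real (y n)) * T n - 0) < e" by blast
  qed
  from tendsto_diff[OF tendsto_const[of "t 0"] this] show ?thesis
    by (simp add: g_eq[abs_def] t_def)
qed

text \<open>At \<open>\<lambda> = exp l\<close> this is \<open>a powr (- \<mu>) * exp \<lambda> * \<lambda> powr (- x - 1) * J\<^sub>\<mu>(a * \<lambda>)\<close>; its termwise integral converges
  absolutely only for \<open>a < 1\<close> in general.\<close>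
definition bessel_kernel :: "complex \<Rightarrow> complex \<Rightarrow> real \<Rightarrow> complex \<Rightarrow> complex" where
  "bessel_kernel \<mu> x a l =
     exp (exp l) * exp (- (x + 1) * l) * (exp (\<mu> * l) * bessel_Phi \<mu> (of_real (a\<^sup>2) * exp (2 * l)))"

lemma continuous_on_bessel_kernel [continuous_intros]: "continuous_on A (bessel_kernel \<mu> x a)"
  unfolding bessel_kernel_def[abs_def] by (intro continuous_intros)

lemma bessel_kernel_sums:
  "(\<lambda>k. bessel_coeff \<mu> k * of_real (a\<^sup>2) ^ k * (exp (exp l) * exp (- (x + 1 - (\<mu> + 2 * of_nat k)) * l)))
     sums bessel_kernel \<mu> x a l"
proof -
  have "bessel_coeff \<mu> k * of_real (a\<^sup>2) ^ k * (exp (exp l) * exp (- (x + 1 - (\<mu> + 2 * of_nat k)) * l))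
     = exp (exp l) * exp (- (x + 1) * l) * (exp (\<mu> * l) * (bessel_coeff \<mu> k * (of_real (a\<^sup>2) * exp (2 * l)) ^ k))" for k
  proof -
    have "exp (- (x + 1 - (\<mu> + 2 * of_nat k)) * l) = exp (- (x + 1) * l) * exp (\<mu> * l) * exp (2 * l) ^ k"
      by (simp add: algebra_simps flip: exp_add exp_of_nat_mult)
    then show ?thesis by (simp add: power_mult_distrib mult_ac)
  qed
  then show ?thesis
    unfolding bessel_kernel_def by (simp only:) (intro sums_mult bessel_Phi_sums)
qed

text \<open>For \<open>a < 1\<close> the majorant of the k-th term grows only like exp (s r) with s
  < 1, so exp \<lambda> leaves exp (- (1 - s) r) on the rays and \<open>\<theta> ^ k\<close> in the
  index. Each term is then an instance of Hankel's formula.\<close>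

lemma hankel_bessel_kernel_sums:
  assumes a: "0 \<le> a" "a < 1" and \<rho>: "\<rho> > 0"
  shows "(\<lambda>k. dBessel_term \<mu> x k * of_real (a\<^sup>2) ^ k) sums
           (Gamma (x + 1) / (2 * \<i> * of_real pi) * hankel_integral \<rho> (bessel_kernel \<mu> x a))"
proof -
  obtain C \<theta> s where C: "0 \<le> C" "0 \<le> \<theta>" "\<theta> < 1" "0 < s" "s < 1"
    "\<And>k r. r \<ge> 0 \<Longrightarrow> norm (bessel_coeff \<mu> k) * (a * r) ^ (2 * k) \<le> C * \<theta> ^ k * exp (s * r)"
    using bessel_coeff_bound[OF a, of \<mu>] by metis
  define \<beta> where "\<beta> = Re (\<mu> - (x + 1))"
  define K where "K = C * exp (2 * \<rho> + pi * \<bar>Im (\<mu> - (x + 1))\<bar>)"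
  have K: "0 \<le> K" using C by (simp add: K_def)
  obtain M where M: "\<And>F K. 0 \<le> K \<Longrightarrow> continuous_on UNIV F \<Longrightarrow>
       (\<And>l. l \<in> hankel_path \<rho> \<Longrightarrow> norm (F l) \<le> K * exp (\<beta> * Re l - (1 - s) * exp (Re l))) \<Longrightarrow>
       hankel_bounded \<rho> F (K * M)"
    using hankel_bounded_growth[of "1 - s" \<rho> \<beta>] C by (metis diff_gt_0_iff_gt)
  define F where "F k l = bessel_coeff \<mu> k * of_real (a\<^sup>2) ^ k * (exp (exp l) * exp (- (x + 1 - (\<mu> + 2 * of_nat k)) * l))" for k l
  have bounded: "hankel_bounded \<rho> (F k) ((K * \<theta> ^ k) * M)" for k
  proof (rule M)
    fix l assume l: "l \<in> hankel_path \<rho>"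
    define r where "r = exp (Re l)"
    have "norm (exp (- (x + 1 - (\<mu> + 2 * of_nat k)) * l))
        \<le> exp (pi * \<bar>Im (\<mu> - (x + 1))\<bar>) * (exp (\<beta> * Re l) * r ^ (2 * k))"
      using norm_exp_mult_hankel_path[OF l, of "- (x + 1 - (\<mu> + 2 * of_nat k))"]
      by (simp add: \<beta>_def r_def algebra_simps flip: exp_add exp_of_nat_mult)
    with norm_exp_exp_hankel_path[OF l \<rho>]
    have "norm (F k l) \<le> norm (bessel_coeff \<mu> k) * (a\<^sup>2) ^ k * (exp (2 * \<rho> - r) *
        (exp (pi * \<bar>Im (\<mu> - (x + 1))\<bar>) * (exp (\<beta> * Re l) * r ^ (2 * k))))"
      unfolding F_def norm_mult r_def[symmetric]
      by (intro mult_mono) (auto simp: norm_power r_def)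
    also have "\<dots> = (norm (bessel_coeff \<mu> k) * (a * r) ^ (2 * k)) *
        (exp (2 * \<rho> - r) * exp (pi * \<bar>Im (\<mu> - (x + 1))\<bar>) * exp (\<beta> * Re l))"
      by (simp add: power_mult_distrib mult_ac flip: power_mult)
    also have "\<dots> \<le> (C * \<theta> ^ k * exp (s * r)) *
        (exp (2 * \<rho> - r) * exp (pi * \<bar>Im (\<mu> - (x + 1))\<bar>) * exp (\<beta> * Re l))"
      by (intro mult_right_mono C(6)) (auto simp: r_def)
    also have "\<dots> = K * \<theta> ^ k * exp (\<beta> * Re l - (1 - s) * exp (Re l))"
      unfolding K_def r_def[symmetric] by (simp add: algebra_simps flip: exp_add)
    finally show "norm (F k l) \<le> K * \<theta> ^ k * exp (\<beta> * Re l - (1 - s) * exp (Re l))" .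
  qed (use K C in \<open>auto simp: F_def[abs_def] intro!: continuous_intros\<close>)
  have "(\<lambda>k. hankel_integral \<rho> (F k)) sums hankel_integral \<rho> (bessel_kernel \<mu> x a)"
  proof (rule hankel_integral_sums[OF bounded])
    show "summable (\<lambda>k. K * \<theta> ^ k * M)"
      using C by (intro summable_mult2 summable_mult summable_geometric) auto
    show "(\<lambda>k. F k l) sums bessel_kernel \<mu> x a l" for l
      unfolding F_def by (rule bessel_kernel_sums)
  qed
  moreover have "hankel_integral \<rho> (F k) = bessel_coeff \<mu> k * of_real (a\<^sup>2) ^ k * (2 * \<i> * of_real pi * rGamma (x + 1 - (\<mu> + 2 * of_nat k)))" for k
    unfolding F_def hankel_integral_cmult hankel_rGamma[OF \<rho>] ..
  ultimately have "(\<lambda>k. bessel_coeff \<mu> k * of_real (a\<^sup>2) ^ k * (2 * \<i> * of_real pi * rGamma (x + 1 - (\<mu> + 2 * of_nat k))))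
     sums hankel_integral \<rho> (bessel_kernel \<mu> x a)" by simp
  from sums_mult[OF this, of "Gamma (x + 1) / (2 * \<i> * of_real pi)"]
  show ?thesis by (simp add: dBessel_term_eq mult_ac)
qed

text \<open>Conditional convergence suffices: the integral is the limit of the absolutely convergent case
  \<open>a < 1\<close>, and the series is its own Abel limit.\<close>
lemma dBesselJ_eq_hankel:
  assumes \<rho>: "\<rho> > 0" and summable: "summable (dBessel_term \<mu> x)" and "s < 1"
    and bound: "\<And>l a. l \<in> hankel_path \<rho> \<Longrightarrow> 1 / 2 \<le> a \<Longrightarrow> a < 1 \<Longrightarrow>
       norm (exp (\<mu> * l) * bessel_Phi \<mu> (of_real (a\<^sup>2) * exp (2 * l))) \<le> K * exp (\<beta> * Re l + s * exp (Re l))"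
  shows "dBesselJ \<mu> x = Gamma (x + 1) / (2 * \<i> * of_real pi) * hankel_integral \<rho> (bessel_kernel \<mu> x 1)"
proof -
  \<comment> \<open>A sequence increasing to 1 that starts at 1/2, so that \<open>bound\<close>
    applies to all its members.\<close>
  define a where "a n = 1 - 1 / real (n + 2)" for n :: nat
  have a: "1 / 2 \<le> a n" "a n < 1" for n by (auto simp: a_def field_simps)
  have a_lim: "a \<longlonglongrightarrow> 1" unfolding a_def
    using tendsto_diff[OF tendsto_const[of 1] LIMSEQ_ignore_initial_segment[OF lim_1_over_n, of 2]] by simp
  have K: "0 \<le> K"
  proof -
    have "0 \<le> K * exp (\<beta> * Re (Complex (ln \<rho>) pi) + s * exp (Re (Complex (ln \<rho>) pi)))"
      using bound[of "Complex (ln \<rho>) pi" "1 / 2"] by (intro order.trans[OF norm_ge_zero]) auto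
    then show ?thesis by (simp add: zero_le_mult_iff)
  qed
  obtain M where M: "\<And>F K. 0 \<le> K \<Longrightarrow> continuous_on UNIV F \<Longrightarrow>
       (\<And>l. l \<in> hankel_path \<rho> \<Longrightarrow> norm (F l) \<le> K * exp ((\<beta> + Re (- (x + 1))) * Re l - (1 - s) * exp (Re l))) \<Longrightarrow>
       hankel_bounded \<rho> F (K * M)"
    using hankel_bounded_growth[of "1 - s" \<rho> "\<beta> + Re (- (x + 1))"] \<open>s < 1\<close> by (metis diff_gt_0_iff_gt)
  have "hankel_bounded \<rho> (bessel_kernel \<mu> x (a n)) (exp (2 * \<rho> + pi * \<bar>Im (- (x + 1))\<bar>) * K * M)" for n
  proof (rule M)
    fix l assume l: "l \<in> hankel_path \<rho>"
    have "norm (bessel_kernel \<mu> x (a n) l) \<le> exp (2 * \<rho> - exp (Re l)) *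
        (exp (pi * \<bar>Im (- (x + 1))\<bar>) * exp (Re (- (x + 1)) * Re l)) * (K * exp (\<beta> * Re l + s * exp (Re l)))"
      unfolding bessel_kernel_def norm_mult[of "exp (exp l) * exp (- (x + 1) * l)"] norm_mult[of "exp (exp l)"]
      by (intro mult_mono norm_exp_exp_hankel_path norm_exp_mult_hankel_path[OF l] l bound a \<rho>) auto
    also have "\<dots> = exp (2 * \<rho> + pi * \<bar>Im (- (x + 1))\<bar>) * K * exp ((\<beta> + Re (- (x + 1))) * Re l - (1 - s) * exp (Re l))"
      by (simp add: algebra_simps flip: exp_add)
    finally show "norm (bessel_kernel \<mu> x (a n) l) \<le> exp (2 * \<rho> + pi * \<bar>Im (- (x + 1))\<bar>) * K * exp ((\<beta> + Re (- (x + 1))) * Re l - (1 - s) * exp (Re l))" .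
  qed (use K in \<open>auto intro!: continuous_intros\<close>)
  moreover have "(\<lambda>n. bessel_kernel \<mu> x (a n) l) \<longlonglongrightarrow> bessel_kernel \<mu> x 1 l" for l
  proof -
    have "(\<lambda>n. bessel_Phi \<mu> (of_real ((a n)\<^sup>2) * exp (2 * l))) \<longlonglongrightarrow> bessel_Phi \<mu> (of_real (1\<^sup>2) * exp (2 * l))"
      by (intro isCont_tendsto_compose[OF DERIV_isCont[OF DERIV_bessel_Phi]] tendsto_intros a_lim)
    then show ?thesis unfolding bessel_kernel_def by (intro tendsto_intros)
  qed
  ultimately have "(\<lambda>n. hankel_integral \<rho> (bessel_kernel \<mu> x (a n))) \<longlonglongrightarrow> hankel_integral \<rho> (bessel_kernel \<mu> x 1)"
    by (rule hankel_dominated_convergence)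
  then have 1: "(\<lambda>n. Gamma (x + 1) / (2 * \<i> * of_real pi) * hankel_integral \<rho> (bessel_kernel \<mu> x (a n)))
      \<longlonglongrightarrow> Gamma (x + 1) / (2 * \<i> * of_real pi) * hankel_integral \<rho> (bessel_kernel \<mu> x 1)"
    by (intro tendsto_intros)
  have 2: "(\<lambda>n. Gamma (x + 1) / (2 * \<i> * of_real pi) * hankel_integral \<rho> (bessel_kernel \<mu> x (a n)))
      \<longlonglongrightarrow> suminf (dBessel_term \<mu> x)"
  proof (rule abel_limit[OF summable, where y = "\<lambda>n. (a n)\<^sup>2"])
    have pos: "0 \<le> a n" for n using a(1)[of n] by simp
    show "0 \<le> (a n)\<^sup>2" "(a n)\<^sup>2 < 1" for n using a[of n] pos[of n] by (auto simp: power_less_one_iff)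
    show "(\<lambda>n. (a n)\<^sup>2) \<longlonglongrightarrow> 1" using tendsto_power[OF a_lim, of 2] by simp
    show "(\<lambda>k. dBessel_term \<mu> x k * of_real ((a n)\<^sup>2) ^ k) sums
        (Gamma (x + 1) / (2 * \<i> * of_real pi) * hankel_integral \<rho> (bessel_kernel \<mu> x (a n)))" for n
      by (rule hankel_bessel_kernel_sums[OF pos a(2) \<rho>])
  qed
  from LIMSEQ_unique[OF 2 1] show ?thesis unfolding dBesselJ_def .
qed

subsection \<open>Generating functions of the half-integral Bessel functions\<close>

text \<open>On the rays \<lambda> = -r the square of the root is almost positive: 2 (Im s)^2 = |s|^2
  - Re (s^2) \<le> 4 r R. Then sqrt (2 r R) \<le> R + r/2 by the inequality of the means. On the
  circle |s| \<le> \<rho> + R is enough. A coefficient of r below 1 is what matters.\<close>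

lemma abs_Im_sqrt_hankel_path:
  assumes l: "l \<in> hankel_path \<rho>" and \<rho>: "\<rho> > 0" and t: "norm t \<le> R"
    and s: "s\<^sup>2 = (exp l)\<^sup>2 + 2 * exp l * t"
  shows "\<bar>Im s\<bar> \<le> \<rho> + R + exp (Re l) / 2"
proof -
  define r where "r = exp (Re l)"
  have r: "r > 0" "norm (exp l) = r" by (simp_all add: r_def)
  have R: "R \<ge> 0" using t norm_ge_zero[of t] by linarith
  have "norm (exp l) * norm t \<le> r * R" using r t by (intro mult_mono) auto
  then have *: "norm (2 * exp l * t) \<le> 2 * r * R" by (simp add: norm_mult)
  have "norm (s\<^sup>2) \<le> norm ((exp l)\<^sup>2) + norm (2 * exp l * t)" unfolding s by (rule norm_triangle_ineq)
  also have "norm ((exp l)\<^sup>2) = r\<^sup>2" by (simp add: norm_power r_def)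
  finally have s1: "(norm s)\<^sup>2 \<le> r\<^sup>2 + 2 * r * R" using * by (simp add: norm_power)
  show ?thesis
  proof (cases "Re l = ln \<rho>")
    case True
    then have r_eq: "r = \<rho>" using \<rho> by (simp add: r_def)
    have "(norm s)\<^sup>2 \<le> (\<rho> + R)\<^sup>2"
      using s1 zero_le_power2[of R] unfolding r_eq power2_sum by linarith
    then have "norm s \<le> \<rho> + R" by (rule power2_le_imp_le) (use \<rho> R in auto)
    with abs_Im_le_cmod[of s] r(1) show ?thesis unfolding r_def by linarith
  next
    case False
    with l have "Im l = pi \<or> Im l = - pi" by (auto simp: hankel_path_def)
    then have e: "exp l = - of_real r" by (auto simp: r_def complex_eq_iff Re_exp Im_exp)
    have "Re (s\<^sup>2) = r\<^sup>2 + Re (2 * exp l * t)" unfolding s e by (simp add: power2_eq_square)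
    moreover have "\<bar>Re (2 * exp l * t)\<bar> \<le> 2 * r * R" by (rule order.trans[OF abs_Re_le_cmod *])
    moreover have "2 * (Im s)\<^sup>2 = (norm s)\<^sup>2 - Re (s\<^sup>2)"
      unfolding cmod_power2 by (simp add: power2_eq_square)
    ultimately have "(Im s)\<^sup>2 \<le> 2 * r * R" using s1 by linarith
    also have "\<dots> = (R + r / 2)\<^sup>2 - (R - r / 2)\<^sup>2"
      by (simp add: power2_eq_square algebra_simps)
    also have "\<dots> \<le> (R + r / 2)\<^sup>2" by simp
    finally have "\<bar>Im s\<bar>\<^sup>2 \<le> (R + r / 2)\<^sup>2" by simp
    then have "\<bar>Im s\<bar> \<le> R + r / 2" by (rule power2_le_imp_le) (use R r in auto)
    then show ?thesis using \<rho> by (simp add: r_def)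
  qed
qed

lemma higher_deriv_family:
  fixes g :: "nat \<Rightarrow> complex \<Rightarrow> complex"
  assumes "\<And>n t. t \<in> ball 0 r \<Longrightarrow> (g n has_field_derivative g (Suc n) t) (at t)" "t \<in> ball 0 r"
  shows "(deriv ^^ n) (g 0) t = g n t"
  using assms(2)
proof (induction n arbitrary: t)
  case (Suc n)
  have "((deriv ^^ n) (g 0) has_field_derivative g (Suc n) t) (at t)"
    by (rule has_field_derivative_transform_within_open[OF assms(1)[OF Suc.prems] open_ball Suc.prems])
       (simp add: Suc.IH)
  then show ?case by (simp add: DERIV_imp_deriv)
qed simp

text \<open>All \<open>g n\<close> are iterated derivatives of \<open>g 0\<close>, so an estimate of
  the elementary function \<open>g 0\<close> on one circle controls every Bessel function of the
  family.\<close>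

lemma taylor_family:
  fixes g :: "nat \<Rightarrow> complex \<Rightarrow> complex"
  assumes g: "\<And>n t. t \<in> ball 0 r \<Longrightarrow> (g n has_field_derivative g (Suc n) t) (at t)"
  shows "norm t < r \<Longrightarrow> (\<lambda>n. g n 0 / fact n * t ^ n) sums g 0 t"
    and "0 < R \<Longrightarrow> R < r \<Longrightarrow> (\<And>t. norm t = R \<Longrightarrow> norm (g 0 t) \<le> B) \<Longrightarrow> norm (g n 0) \<le> fact n * B / R ^ n"
proof -
  have hol: "g 0 holomorphic_on ball 0 r"
    using g unfolding holomorphic_on_open[OF open_ball] by blast
  show "(\<lambda>n. g n 0 / fact n * t ^ n) sums g 0 t" if "norm t < r"
  proof -
    have "0 \<in> ball (0::complex) r" using le_less_trans[OF norm_ge_zero that] by simp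
    then show ?thesis
      using holomorphic_power_series[OF hol, of t] higher_deriv_family[of r g 0] g that by simp
  qed
  assume R: "0 < R" "R < r" and B: "\<And>t. norm t = R \<Longrightarrow> norm (g 0 t) \<le> B"
  have "norm ((deriv ^^ n) (g 0) 0) \<le> fact n * B / R ^ n"
  proof (rule Cauchy_inequality)
    show "g 0 holomorphic_on ball 0 R" by (rule holomorphic_on_subset[OF hol]) (use R in auto)
    show "continuous_on (cball 0 R) (g 0)"
      by (rule holomorphic_on_imp_continuous_on[OF holomorphic_on_subset[OF hol]]) (use R in auto)
  qed (use R B in auto)
  then show "norm (g n 0) \<le> fact n * B / R ^ n"
    using higher_deriv_family[of r g 0 n] g R by simp
qed

text \<open>\<open>sqrt (pi * \<lambda> / 2) * J\<^sub>\<mu>(\<lambda>)\<close> at \<open>\<lambda> = exp l\<close>.\<close>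
definition bessel_gen :: "complex \<Rightarrow> complex \<Rightarrow> complex" where
  "bessel_gen \<mu> l = of_real (sqrt (pi / 2)) * exp ((\<mu> + 1 / 2) * l) * bessel_Phi \<mu> (exp (2 * l))"

definition cos_family :: "complex \<Rightarrow> nat \<Rightarrow> complex \<Rightarrow> complex" where
  "cos_family l n t = of_real (sqrt (pi / 2)) * exp l ^ n
     * bessel_Phi (of_nat n - 1 / 2) ((exp l)\<^sup>2 - 2 * exp l * t)"

text \<open>The inner derivative \<open>- (2 * exp l)\<close> cancels the \<open>- 1 / 2\<close> of
  \<open>DERIV_bessel_Phi\<close>, leaving one more factor \<open>exp l\<close> and the next
  index.\<close>

lemma cos_family:
  shows "(cos_family l n has_field_derivative cos_family l (Suc n) t) (at t)"
    and "cos_family l 0 t = cos (csqrt ((exp l)\<^sup>2 - 2 * exp l * t))"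
    and "cos_family l n 0 = bessel_gen (of_nat n - 1 / 2) l"
proof -
  have "((\<lambda>t. bessel_Phi (of_nat n - 1 / 2) ((exp l)\<^sup>2 - 2 * exp l * t)) has_field_derivative
      - bessel_Phi (of_nat n - 1 / 2 + 1) ((exp l)\<^sup>2 - 2 * exp l * t) / 2 * (- (2 * exp l))) (at t)"
    by (rule DERIV_chain2[OF DERIV_bessel_Phi]) (auto intro!: derivative_eq_intros)
  from DERIV_cmult[OF this, of "of_real (sqrt (pi / 2)) * exp l ^ n"]
  show "(cos_family l n has_field_derivative cos_family l (Suc n) t) (at t)"
    unfolding cos_family_def[abs_def] by (simp add: algebra_simps)
  show "cos_family l 0 t = cos (csqrt ((exp l)\<^sup>2 - 2 * exp l * t))"
    by (simp add: cos_family_def cos_eq_bessel_Phi)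
  show "cos_family l n 0 = bessel_gen (of_nat n - 1 / 2) l"
    unfolding cos_family_def bessel_gen_def exp_double exp_of_nat_mult[symmetric] by simp
qed

text \<open>\<open>sin_log l t\<close> is the logarithm of the root \<open>\<lambda> * sqrt (1 + 2 t / \<lambda>)\<close>.\<close>
definition sin_log :: "complex \<Rightarrow> complex \<Rightarrow> complex" where
  "sin_log l t = l + Ln (1 + 2 * t / exp l) / 2"

text \<open>With s the root exp (sin_log l t) and \<mu> = 1/2 - n, the bracket is s^(2 \<mu>)
  \<Phi>_\<mu>(s^2) = s^\<mu> J_\<mu>(s). The power of s is what calls for a logarithm of the
  root.\<close>

definition sin_family :: "complex \<Rightarrow> nat \<Rightarrow> complex \<Rightarrow> complex" where
  "sin_family l n t = of_real (sqrt (pi / 2)) * exp l ^ n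
     * (exp (2 * (- of_nat n + 1 / 2) * sin_log l t) * bessel_Phi (- of_nat n + 1 / 2) (exp (2 * sin_log l t)))"

text \<open>The bound on \<open>t\<close> keeps 1 + 2 t / \<lambda> in the right half plane, off the
  cut of \<open>Ln\<close>.\<close>

lemma sin_log:
  assumes t: "norm t < exp (Re l) / 2"
  shows "exp (sin_log l t) = exp l * csqrt (1 + 2 * t / exp l)"
    and "(sin_log l has_field_derivative exp l * exp (- (2 * sin_log l t))) (at t)"
proof -
  define w where "w = 1 + 2 * t / exp l"
  have "norm (2 * t / exp l) < 1" using t by (simp add: norm_divide norm_mult field_simps)
  then have "\<bar>Re (2 * t / exp l)\<bar> < 1" using abs_Re_le_cmod le_less_trans by blast
  then have "Re w > 0" by (simp add: w_def)
  then have w: "w \<noteq> 0" "w \<notin> \<real>\<^sub>\<le>\<^sub>0" by (auto simp: complex_nonpos_Reals_iff)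
  show e: "exp (sin_log l t) = exp l * csqrt (1 + 2 * t / exp l)"
    using csqrt_exp_Ln[OF w(1)] by (simp add: sin_log_def exp_add w_def)
  have "exp (2 * sin_log l t) = (exp l)\<^sup>2 * w"
    unfolding exp_double e by (simp add: power_mult_distrib w_def)
  then have e2: "exp (- (2 * sin_log l t)) = inverse ((exp l)\<^sup>2 * w)" by (simp add: exp_minus)
  have "((\<lambda>t. 1 + 2 * t / exp l) has_field_derivative 2 / exp l) (at t)"
    by (auto intro!: derivative_eq_intros)
  from DERIV_chain2[OF has_field_derivative_Ln this] w(2)
  have "((\<lambda>t. Ln (1 + 2 * t / exp l)) has_field_derivative inverse w * (2 / exp l)) (at t)"
    unfolding w_def by simp
  from DERIV_add[OF DERIV_const DERIV_cdivide[OF this]]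
  have "(sin_log l has_field_derivative 0 + inverse w * (2 / exp l) / 2) (at t)"
    unfolding sin_log_def[abs_def] .
  then show "(sin_log l has_field_derivative exp l * exp (- (2 * sin_log l t))) (at t)"
    unfolding e2 by (simp add: power2_eq_square field_simps)
qed

text \<open>The counterpart for falling index: z^\<mu> J_\<mu> has derivative z^\<mu> J_(\<mu>-1).
  The product rule produces exactly the left side of \<open>bessel_Phi_recurrence\<close>.\<close>

lemma sin_family:
  assumes t: "norm t < exp (Re l) / 2"
  shows "(sin_family l n has_field_derivative sin_family l (Suc n) t) (at t)"
    and "sin_family l 0 t = sin (exp l * csqrt (1 + 2 * t / exp l))"
    and "sin_family l n 0 = bessel_gen (- of_nat n + 1 / 2) l"
proof -
  define \<mu> :: complex where "\<mu> = - of_nat n + 1 / 2"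
  define m where "m = sin_log l t"
  have \<mu>1: "- of_nat (Suc n) + 1 / 2 = \<mu> - 1" by (simp add: \<mu>_def)
  have m: "(sin_log l has_field_derivative exp l * exp (- (2 * m))) (at t)"
    unfolding m_def by (rule sin_log(2)[OF t])
  have e: "((\<lambda>t. exp (2 * sin_log l t)) has_field_derivative exp (2 * m) * (2 * (exp l * exp (- (2 * m))))) (at t)"
    unfolding m_def by (rule DERIV_chain2[OF DERIV_exp DERIV_cmult[OF m[unfolded m_def]]])
  have p: "((\<lambda>t. exp (2 * \<mu> * sin_log l t)) has_field_derivative exp (2 * \<mu> * m) * (2 * \<mu> * (exp l * exp (- (2 * m))))) (at t)"
    unfolding m_def by (rule DERIV_chain2[OF DERIV_exp DERIV_cmult[OF m[unfolded m_def]]])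
  have "((\<lambda>t. exp (2 * \<mu> * sin_log l t) * bessel_Phi \<mu> (exp (2 * sin_log l t))) has_field_derivative
      exp (2 * \<mu> * m) * (2 * \<mu> * (exp l * exp (- (2 * m)))) * bessel_Phi \<mu> (exp (2 * m)) +
      - bessel_Phi (\<mu> + 1) (exp (2 * m)) / 2 * (exp (2 * m) * (2 * (exp l * exp (- (2 * m))))) * exp (2 * \<mu> * m)) (at t)"
    using DERIV_mult[OF p DERIV_chain2[OF DERIV_bessel_Phi e]] unfolding m_def .
  also have "exp (2 * \<mu> * m) * (2 * \<mu> * (exp l * exp (- (2 * m)))) * bessel_Phi \<mu> (exp (2 * m)) +
      - bessel_Phi (\<mu> + 1) (exp (2 * m)) / 2 * (exp (2 * m) * (2 * (exp l * exp (- (2 * m))))) * exp (2 * \<mu> * m)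
      = 2 * exp (2 * \<mu> * m) * exp (- (2 * m)) * exp l *
        (\<mu> * bessel_Phi \<mu> (exp (2 * m)) - exp (2 * m) * bessel_Phi (\<mu> + 1) (exp (2 * m)) / 2)"
    by (simp add: algebra_simps)
  also have "\<dots> = exp l * (exp (2 * (\<mu> - 1) * m) * bessel_Phi (\<mu> - 1) (exp (2 * m)))"
    unfolding bessel_Phi_recurrence by (simp add: algebra_simps flip: exp_add)
  finally have D: "((\<lambda>t. exp (2 * \<mu> * sin_log l t) * bessel_Phi \<mu> (exp (2 * sin_log l t))) has_field_derivative
      exp l * (exp (2 * (\<mu> - 1) * m) * bessel_Phi (\<mu> - 1) (exp (2 * m)))) (at t)" .
  show "(sin_family l n has_field_derivative sin_family l (Suc n) t) (at t)"
    using DERIV_cmult[OF D, of "of_real (sqrt (pi / 2)) * exp l ^ n"]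
    unfolding sin_family_def[abs_def] \<mu>1 \<mu>_def[symmetric] m_def by (simp add: mult_ac)
  have s: "exp (2 * (- of_nat 0 + 1 / 2) * sin_log l t) = exp (sin_log l t)" by simp
  show "sin_family l 0 t = sin (exp l * csqrt (1 + 2 * t / exp l))"
    unfolding sin_log(1)[OF t, symmetric] sin_eq_bessel_Phi sin_family_def s exp_double
    by simp
  show "sin_family l n 0 = bessel_gen (- of_nat n + 1 / 2) l"
    by (simp add: sin_family_def bessel_gen_def sin_log_def algebra_simps flip: exp_add exp_of_nat_mult)
qed

lemma cos_bessel_gen_sums:
  "(\<lambda>n. bessel_gen (of_nat n - 1 / 2) l / fact n * t ^ n) sums cos (csqrt ((exp l)\<^sup>2 - 2 * exp l * t))"
  using taylor_family(1)[of "norm t + 1" "cos_family l" t] cos_family by simp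

lemma norm_bessel_gen_cos_le:
  assumes l: "l \<in> hankel_path \<rho>" and "\<rho> > 0" "R > 0"
  shows "norm (bessel_gen (of_nat n - 1 / 2) l) \<le> fact n * exp (\<rho> + R + exp (Re l) / 2) / R ^ n"
  unfolding cos_family(3)[symmetric]
\<comment> \<open>The family is entire in \<open>t\<close>, so any radius above \<open>R\<close>
  will do.\<close>
proof (rule taylor_family(2)[where r = "R + 1"])
  fix t :: complex assume t: "norm t = R"
  define s where "s = csqrt ((exp l)\<^sup>2 - 2 * exp l * t)"
  have "\<bar>Im s\<bar> \<le> \<rho> + R + exp (Re l) / 2"
    by (rule abs_Im_sqrt_hankel_path[OF l \<open>\<rho> > 0\<close>, of "- t"]) (use t in \<open>auto simp: s_def\<close>)
  moreover have "norm (cos s) \<le> exp \<bar>Im s\<bar>" using cmod_cos_le_exp[of 1 s] by simp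
  ultimately have "norm (cos s) \<le> exp (\<rho> + R + exp (Re l) / 2)" by (meson exp_le_cancel_iff order.trans)
  then show "norm (cos_family l 0 t) \<le> exp (\<rho> + R + exp (Re l) / 2)"
    unfolding cos_family(2) s_def .
qed (use assms cos_family(1) in auto)

lemma sin_bessel_gen_sums:
  assumes "norm t < exp (Re l) / 2"
  shows "(\<lambda>n. bessel_gen (- of_nat n + 1 / 2) l / fact n * t ^ n) sums sin (exp l * csqrt (1 + 2 * t / exp l))"
proof -
  have "(sin_family l n has_field_derivative sin_family l (Suc n) t) (at t)" if "t \<in> ball 0 (exp (Re l) / 2)" for n t
    using sin_family(1) that by simp
  from taylor_family(1)[of "exp (Re l) / 2" "sin_family l" t, OF this assms] show ?thesis
    using sin_family(2)[OF assms] sin_family(3)[OF assms] by simp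
qed

text \<open>The root is analytic for |t| < |\<lambda>| / 2, and |\<lambda>| \<ge> \<rho> on the
  contour; \<open>2 * R < \<rho>\<close> keeps the Cauchy circle inside.\<close>

lemma norm_bessel_gen_sin_le:
  assumes l: "l \<in> hankel_path \<rho>" and \<rho>: "\<rho> > 0" and R: "R > 0" "2 * R < \<rho>"
  shows "norm (bessel_gen (- of_nat n + 1 / 2) l) \<le> fact n * exp (\<rho> + R + exp (Re l) / 2) / R ^ n"
proof -
  have "exp (ln \<rho>) \<le> exp (Re l)" unfolding exp_le_cancel_iff by (rule hankel_pathD(1)[OF l])
  then have "\<rho> \<le> exp (Re l)" using \<rho> by simp
  then have Rr: "R < exp (Re l) / 2" using R by simp
  have "norm (sin_family l n 0) \<le> fact n * exp (\<rho> + R + exp (Re l) / 2) / R ^ n"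
  proof (rule taylor_family(2)[where r = "exp (Re l) / 2"])
    fix t :: complex assume t: "norm t = R"
    define s where "s = exp l * csqrt (1 + 2 * t / exp l)"
    have "s\<^sup>2 = (exp l)\<^sup>2 + 2 * exp l * t"
      by (simp add: s_def power_mult_distrib) (simp add: power2_eq_square field_simps)
    then have "\<bar>Im s\<bar> \<le> \<rho> + R + exp (Re l) / 2"
      by (intro abs_Im_sqrt_hankel_path[OF l \<open>\<rho> > 0\<close>, of t]) (use t in auto)
    moreover have "norm (sin s) \<le> exp \<bar>Im s\<bar>" using cmod_sin_le_exp[of 1 s] by simp
    ultimately have "norm (sin s) \<le> exp (\<rho> + R + exp (Re l) / 2)" by (meson exp_le_cancel_iff order.trans)
    then show "norm (sin_family l 0 t) \<le> exp (\<rho> + R + exp (Re l) / 2)"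
      using sin_family(2)[of t l] t Rr by (simp add: s_def)
  qed (use assms sin_family(1) Rr in auto)
  then show ?thesis using sin_family(3)[of 0 l n] by simp
qed

subsection \<open>Integration of the generating functions\<close>

text \<open>The limit in \<open>a\<close> needs the kernel at \<open>a * \<lambda>\<close>. If
  \<lambda> runs over the contour of radius \<rho>, then \<open>a * \<lambda>\<close> runs over the
  one of radius \<open>a * \<rho>\<close>, and 1/2 \<le> a < 1 gives the range of
  \<open>\<rho>'\<close>.\<close>

lemma dBesselJ_eq_hankel_of_bessel_gen:
  assumes \<rho>: "\<rho> > 0" and summable: "summable (dBessel_term \<mu> x)" and B: "B \<ge> 0"
    and bound: "\<And>\<rho>' l. \<rho> / 2 \<le> \<rho>' \<Longrightarrow> \<rho>' \<le> \<rho> \<Longrightarrow> l \<in> hankel_path \<rho>' \<Longrightarrow>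
       norm (bessel_gen \<mu> l) \<le> B * exp (exp (Re l) / 2)"
  shows "dBesselJ \<mu> x = Gamma (x + 1) / (2 * \<i> * of_real pi) * hankel_integral \<rho> (bessel_kernel \<mu> x 1)"
proof (rule dBesselJ_eq_hankel[OF \<rho> summable])
  \<comment> \<open>Rescaling costs a factor a^(- Re \<mu> - 1/2), at most 2 to the power
    \<open>\<bar>Re \<mu> + 1 / 2\<bar>\<close>.\<close>
  define K where "K = exp (\<bar>Re \<mu> + 1 / 2\<bar> * ln 2) * B / sqrt (pi / 2)"
  fix l and a :: real assume l: "l \<in> hankel_path \<rho>" and a: "1 / 2 \<le> a" "a < 1"
  define l' where "l' = l + of_real (ln a)"
  have a0: "a > 0" using a by simp
  have ln_a: "ln (1 / 2) \<le> ln a" using a a0 by (subst ln_le_cancel_iff) auto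
  have "ln (a * \<rho>) = ln \<rho> + ln a" using a0 \<rho> by (simp add: ln_mult)
  then have l': "l' \<in> hankel_path (a * \<rho>)" using l by (auto simp: hankel_path_def l'_def)
  have "bessel_gen \<mu> l' = of_real (sqrt (pi / 2)) * exp ((\<mu> + 1 / 2) * of_real (ln a)) * exp (l / 2)
      * (exp (\<mu> * l) * bessel_Phi \<mu> (of_real (a\<^sup>2) * exp (2 * l)))"
  proof -
    have "exp (2 * of_real (ln a)) = complex_of_real (a\<^sup>2)"
      unfolding exp_double exp_of_real using a0 by simp
    then have 1: "exp (2 * l') = of_real (a\<^sup>2) * exp (2 * l)"
      by (simp add: l'_def distrib_left exp_add)
    have 2: "exp ((\<mu> + 1 / 2) * l') = exp ((\<mu> + 1 / 2) * of_real (ln a)) * exp (l / 2) * exp (\<mu> * l)"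
      by (simp add: l'_def algebra_simps add_divide_distrib flip: exp_add)
    show ?thesis unfolding bessel_gen_def 1 2 by (simp only: mult_ac)
  qed
  then have "exp (\<mu> * l) * bessel_Phi \<mu> (of_real (a\<^sup>2) * exp (2 * l))
      = exp (- ((\<mu> + 1 / 2) * of_real (ln a))) * exp (- (l / 2)) * bessel_gen \<mu> l' / of_real (sqrt (pi / 2))"
  proof -
    have "w = inverse u * inverse v * b / c" if "b = c * u * v * w" "u \<noteq> 0" "v \<noteq> 0" "c \<noteq> 0" for b c u v w :: complex
      using that by (simp add: field_simps)
    from this[OF \<open>bessel_gen \<mu> l' = _\<close>] show ?thesis by (simp add: exp_minus)
  qed
  then have "norm (exp (\<mu> * l) * bessel_Phi \<mu> (of_real (a\<^sup>2) * exp (2 * l)))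
      = exp (- (Re \<mu> + 1 / 2) * ln a) * exp (- Re l / 2) * norm (bessel_gen \<mu> l') / sqrt (pi / 2)"
    by (simp add: norm_mult norm_divide norm_exp_eq_Re algebra_simps)
  also have "\<dots> \<le> exp (\<bar>Re \<mu> + 1 / 2\<bar> * ln 2) * exp (- Re l / 2) * (B * exp (1 / 2 * exp (Re l))) / sqrt (pi / 2)"
  proof (intro divide_right_mono mult_mono)
    have "- (Re \<mu> + 1 / 2) * ln a \<le> \<bar>Re \<mu> + 1 / 2\<bar> * \<bar>ln a\<bar>"
      using abs_ge_self[of "- (Re \<mu> + 1 / 2) * ln a"] unfolding abs_mult abs_minus_cancel .
    also have "\<bar>ln a\<bar> \<le> ln 2" using ln_a a a0 by (simp add: ln_div)
    finally show "exp (- (Re \<mu> + 1 / 2) * ln a) \<le> exp (\<bar>Re \<mu> + 1 / 2\<bar> * ln 2)"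
      by (simp add: mult_left_mono)
    have "norm (bessel_gen \<mu> l') \<le> B * exp (exp (Re l') / 2)"
      using a \<rho> by (intro bound[OF _ _ l']) auto
    also have "exp (Re l') \<le> exp (Re l)" using a a0 by (simp add: l'_def)
    finally show "norm (bessel_gen \<mu> l') \<le> B * exp (1 / 2 * exp (Re l))" using B by (simp add: mult_left_mono)
  qed (use B in auto)
  also have "\<dots> = K * exp (- (1 / 2) * Re l + 1 / 2 * exp (Re l))"
    unfolding K_def exp_add by simp
  finally show "norm (exp (\<mu> * l) * bessel_Phi \<mu> (of_real (a\<^sup>2) * exp (2 * l)))
    \<le> K * exp (- (1 / 2) * Re l + 1 / 2 * exp (Re l))" .
qed simp

lemma bessel_kernel_eq_bessel_gen:
  "bessel_kernel \<mu> x 1 l = exp (exp l) * exp (- (x + 1) * l) * exp (- l / 2) * bessel_gen \<mu> l / of_real (sqrt (pi / 2))"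
proof -
  have "exp (- l / 2) * exp ((\<mu> + 1 / 2) * l) = exp (\<mu> * l)"
    by (simp add: algebra_simps flip: exp_add)
  moreover have "exp (- l / 2) * bessel_gen \<mu> l
      = of_real (sqrt (pi / 2)) * ((exp (- l / 2) * exp ((\<mu> + 1 / 2) * l)) * bessel_Phi \<mu> (exp (2 * l)))"
    unfolding bessel_gen_def by (simp only: mult_ac)
  ultimately have "exp (- l / 2) * bessel_gen \<mu> l = of_real (sqrt (pi / 2)) * (exp (\<mu> * l) * bessel_Phi \<mu> (exp (2 * l)))"
    by simp
  then show ?thesis by (simp add: bessel_kernel_def mult.assoc)
qed

text \<open>\<open>M\<close> depends on neither \<open>n\<close> nor \<open>x\<close> in the disc of
  radius \<open>X\<close>: this uniformity is what the Weierstrass test consumes.\<close>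

lemma hankel_bounded_bessel_kernel:
  fixes \<nu> :: "nat \<Rightarrow> complex" and X :: real
  assumes \<rho>: "\<rho> > 0" and R: "R > 0" and B: "B \<ge> 0"
    and bound: "\<And>n l. l \<in> hankel_path \<rho> \<Longrightarrow> norm (bessel_gen (\<nu> n) l) \<le> fact n * B / R ^ n * exp (exp (Re l) / 2)"
  obtains M where "0 \<le> M"
    "\<And>n x. norm x \<le> X \<Longrightarrow> hankel_bounded \<rho> (bessel_kernel (\<nu> n) x 1) (M * (fact n / R ^ n))"
proof (cases "X \<ge> 0")
  case False
  then have "\<not> norm x \<le> X" for x :: complex using norm_ge_zero[of x] by linarith
  then show ?thesis by (intro that[of 0]) auto
next
  case X: True
  \<comment> \<open>The kernel carries |\<lambda>| to the power - (Re x + 3/2), from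
    \<lambda>^(-x-1) and \<lambda>^(-1/2); its absolute value is at most
    \<open>X + 3 / 2\<close>.\<close>
  define \<beta> where "\<beta> = X + 3 / 2"
  obtain M where M: "0 \<le> M" "\<And>F K. 0 \<le> K \<Longrightarrow> continuous_on UNIV F \<Longrightarrow>
       (\<And>l. l \<in> hankel_path \<rho> \<Longrightarrow> norm (F l) \<le> K * exp (\<beta> * Re l - (1 / 2) * exp (Re l))) \<Longrightarrow>
       hankel_bounded \<rho> F (K * M)"
    by (rule hankel_bounded_growth[of "1 / 2" \<rho> \<beta>]) (simp, blast)
  define E where "E = exp (2 * \<rho> + pi * X + 2 * \<beta> * \<bar>ln \<rho>\<bar>) * B / sqrt (pi / 2)"
  have E: "0 \<le> E" using B by (simp add: E_def)
  show ?thesis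
  proof (rule that[of "E * M"])
    show "0 \<le> E * M" using E M by simp
    fix n and x :: complex assume x: "norm x \<le> X"
    have "hankel_bounded \<rho> (bessel_kernel (\<nu> n) x 1) (E * (fact n / R ^ n) * M)"
    proof (rule M(2))
      fix l assume l: "l \<in> hankel_path \<rho>"
      define r where "r = exp (Re l)"
      have "\<bar>Im x\<bar> \<le> X" using x abs_Im_le_cmod[of x] by linarith
      then have 1: "exp (pi * \<bar>Im (- (x + 1))\<bar>) \<le> exp (pi * X)" by simp
      define c where "c = - (Re x + 3 / 2)"
      have c: "\<bar>c\<bar> \<le> \<beta>" using x abs_Re_le_cmod[of x] by (simp add: \<beta>_def c_def)
      \<comment> \<open>\<open>Re l\<close> may be negative when \<rho> < 1. Measured from
        \<open>ln \<rho>\<close> it is not, and the correction accounts for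
        \<open>2 * \<beta> * \<bar>ln \<rho>\<bar>\<close> in \<open>E\<close>.\<close>
      have "c * Re l = c * (Re l - ln \<rho>) + c * ln \<rho>" by (simp add: algebra_simps)
      also have "\<dots> \<le> \<beta> * (Re l - ln \<rho>) + \<beta> * \<bar>ln \<rho>\<bar>"
      proof (rule add_mono)
        show "c * (Re l - ln \<rho>) \<le> \<beta> * (Re l - ln \<rho>)"
          using c hankel_pathD(1)[OF l] by (intro mult_right_mono) auto
        show "c * ln \<rho> \<le> \<beta> * \<bar>ln \<rho>\<bar>"
          using abs_ge_self[of "c * ln \<rho>"] mult_right_mono[OF c abs_ge_zero[of "ln \<rho>"]]
          unfolding abs_mult by linarith
      qed
      also have "\<dots> \<le> \<beta> * Re l + 2 * \<beta> * \<bar>ln \<rho>\<bar>"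
      proof -
        have "0 \<le> \<beta>" using X by (simp add: \<beta>_def)
        from mult_left_mono[OF abs_ge_minus_self[of "ln \<rho>"] this] show ?thesis by (simp add: right_diff_distrib)
      qed
      finally have "- (Re x + 3 / 2) * Re l \<le> \<beta> * Re l + 2 * \<beta> * \<bar>ln \<rho>\<bar>" unfolding c_def .
      then have 2: "exp (Re (- (x + 1)) * Re l) * exp (- Re l / 2) \<le> exp (\<beta> * Re l + 2 * \<beta> * \<bar>ln \<rho>\<bar>)"
        by (simp add: algebra_simps flip: exp_add)
      have "norm (bessel_kernel (\<nu> n) x 1 l)
          = norm (exp (exp l)) * norm (exp (- (x + 1) * l)) * exp (- Re l / 2) * norm (bessel_gen (\<nu> n) l) / sqrt (pi / 2)"
        unfolding bessel_kernel_eq_bessel_gen norm_mult norm_divide by (simp add: norm_exp_eq_Re)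
      also have "\<dots> \<le> exp (2 * \<rho> - r) * (exp (pi * \<bar>Im (- (x + 1))\<bar>) * exp (Re (- (x + 1)) * Re l)) * exp (- Re l / 2)
          * (fact n * B / R ^ n * exp (r / 2)) / sqrt (pi / 2)"
        unfolding r_def using B R
        by (intro divide_right_mono mult_mono norm_exp_exp_hankel_path norm_exp_mult_hankel_path[OF l] l bound \<rho> order_refl)
           auto
      also have "\<dots> = exp (2 * \<rho> - r) * exp (pi * \<bar>Im (- (x + 1))\<bar>) * (exp (Re (- (x + 1)) * Re l) * exp (- Re l / 2))
          * (fact n * B / R ^ n * exp (r / 2)) / sqrt (pi / 2)"
        by (simp only: mult_ac)
      also have "\<dots> \<le> exp (2 * \<rho> - r) * exp (pi * X) * exp (\<beta> * Re l + 2 * \<beta> * \<bar>ln \<rho>\<bar>)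
          * (fact n * B / R ^ n * exp (r / 2)) / sqrt (pi / 2)"
        using B R by (intro divide_right_mono mult_mono order_refl 1 2) auto
      also have "\<dots> = E * (fact n / R ^ n) * exp (\<beta> * Re l - 1 / 2 * exp (Re l))"
      proof -
        have "exp (2 * \<rho> - r) * exp (pi * X) * exp (\<beta> * Re l + 2 * \<beta> * \<bar>ln \<rho>\<bar>) * exp (r / 2)
           = exp (2 * \<rho> + pi * X + 2 * \<beta> * \<bar>ln \<rho>\<bar>) * exp (\<beta> * Re l - 1 / 2 * r)"
          by (simp add: algebra_simps flip: exp_add)
        then show ?thesis unfolding E_def r_def[symmetric] by (simp add: mult_ac) 
      qed
      finally show "norm (bessel_kernel (\<nu> n) x 1 l) \<le> E * (fact n / R ^ n) * exp (\<beta> * Re l - 1 / 2 * exp (Re l))" .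
    qed (use E R in \<open>auto intro!: continuous_intros\<close>)
    then show "hankel_bounded \<rho> (bessel_kernel (\<nu> n) x 1) (E * M * (fact n / R ^ n))"
      by (simp add: mult_ac)
  qed
qed

text \<open>Reflection gives rGamma (-x) = - sin (pi x) Gamma (x + 1) / pi. The sine cancels the
  denominator of the prefactor, the two phases multiply to -1, and the square roots to 1.\<close>

lemma hankel_constant:
  assumes x: "x \<notin> \<int>"
  shows "hankel_prefactor x * (exp (\<i> * of_real pi * (x + 1)) * rGamma (- x) * of_real (sqrt (pi / 2)))
       = Gamma (x + 1) / (2 * \<i> * of_real pi)"
proof -
  have s0: "sin (of_real pi * x) \<noteq> 0"
  proof
    assume "sin (of_real pi * x) = 0"
    then obtain n :: int where "of_real pi * x = of_real (of_int n) * of_real pi"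
      unfolding sin_eq_0 by auto
    then have "x = of_int n" by simp
    with x show False by simp
  qed
  have "x + 1 \<notin> \<int>\<^sub>\<le>\<^sub>0"
  proof
    assume "x + 1 \<in> \<int>\<^sub>\<le>\<^sub>0"
    then have "x + 1 - 1 \<in> \<int>" by (intro Ints_diff) auto
    with x show False by simp
  qed
  then have G: "Gamma (x + 1) * rGamma (x + 1) = 1"
    by (simp add: rGamma_inverse_Gamma Gamma_eq_zero_iff)
  have "rGamma (- x) * rGamma (x + 1) = - sin (of_real pi * x) / of_real pi"
    using rGamma_reflection_complex[of "- x"] by (simp add: add.commute)
  moreover have "rGamma (- x) * (Gamma (x + 1) * rGamma (x + 1)) = (rGamma (- x) * rGamma (x + 1)) * Gamma (x + 1)"
    by (simp only: mult_ac)
  ultimately have r: "rGamma (- x) = - sin (of_real pi * x) * Gamma (x + 1) / of_real pi"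
    unfolding G by simp
  have e: "exp (- \<i> * of_real pi * x) * exp (\<i> * of_real pi * (x + 1)) = - 1"
    by (simp add: algebra_simps flip: exp_add)
  have q: "complex_of_real (sqrt (2 / pi)) * of_real (sqrt (pi / 2)) = 1"
    by (simp flip: of_real_mult real_sqrt_mult)
  have "hankel_prefactor x * (exp (\<i> * of_real pi * (x + 1)) * rGamma (- x) * of_real (sqrt (pi / 2)))
    = (complex_of_real (sqrt (2 / pi)) * of_real (sqrt (pi / 2))) *
      (exp (- \<i> * of_real pi * x) * exp (\<i> * of_real pi * (x + 1))) * rGamma (- x) / (2 * \<i> * sin (of_real pi * x))"
    unfolding hankel_prefactor_def by (simp only: times_divide_eq_left times_divide_eq_right mult_ac)
  also have "\<dots> = Gamma (x + 1) / (2 * \<i> * of_real pi)"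
    unfolding q e r using s0 by (simp add: field_simps)
  finally show ?thesis .
qed

text \<open>The n!/R^n in the bound cancels the n! of the Taylor series and leaves a geometric
  series of ratio |t| / R < 1, which permits termwise integration.\<close>

lemma hankel_generating_function:
  fixes \<nu> :: "nat \<Rightarrow> complex"
  assumes x: "x \<notin> \<int>" and \<rho>: "\<rho> > 0" and t: "norm t < R" and B: "B \<ge> 0"
    and bound: "\<And>n l. l \<in> hankel_path \<rho> \<Longrightarrow> norm (bessel_gen (\<nu> n) l) \<le> fact n * B / R ^ n * exp (exp (Re l) / 2)"
    and J: "\<And>n. dBesselJ (\<nu> n) x = Gamma (x + 1) / (2 * \<i> * of_real pi) * hankel_integral \<rho> (bessel_kernel (\<nu> n) x 1)"
    and f: "\<And>l. l \<in> hankel_path \<rho> \<Longrightarrow> (\<lambda>n. bessel_gen (\<nu> n) l / fact n * t ^ n) sums f l"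
  shows "(\<lambda>n. dBesselJ (\<nu> n) x * t ^ n / fact n) sums
    (hankel_prefactor x * hankel_integral \<rho>
      (\<lambda>l. exp (exp l) * exp ((- x - 1) * (l - \<i> * of_real pi)) * exp (- l / 2) * f l * rGamma (- x)))"
proof -
  have R: "R > 0" using t norm_ge_zero[of t] by linarith
  obtain M where M: "0 \<le> M"
    "\<And>n y. norm y \<le> norm x \<Longrightarrow> hankel_bounded \<rho> (bessel_kernel (\<nu> n) y 1) (M * (fact n / R ^ n))"
    using hankel_bounded_bessel_kernel[OF \<rho> R B bound] by blast
  define c where "c = exp (\<i> * of_real pi * (x + 1)) * rGamma (- x) * of_real (sqrt (pi / 2))"
  define F where "F n = (\<lambda>l. c * t ^ n / fact n * bessel_kernel (\<nu> n) x 1 l)" for n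
  have F: "hankel_bounded \<rho> (F n) (norm (c * t ^ n / fact n) * (M * (fact n / R ^ n)))" for n
    unfolding F_def by (intro hankel_bounded_cmult M(2)) simp
  have "(\<lambda>n. hankel_integral \<rho> (F n)) sums hankel_integral \<rho>
      (\<lambda>l. exp (exp l) * exp ((- x - 1) * (l - \<i> * of_real pi)) * exp (- l / 2) * f l * rGamma (- x))"
  proof (rule hankel_integral_sums[OF F])
    have "summable (\<lambda>n. norm c * M * (norm t / R) ^ n)"
      using t R by (intro summable_mult summable_geometric) simp
    also have "(\<lambda>n. norm c * M * (norm t / R) ^ n) = (\<lambda>n. norm (c * t ^ n / fact n) * (M * (fact n / R ^ n)))"
      by (simp add: norm_mult norm_divide norm_power power_divide mult_ac)
    finally show "summable (\<lambda>n. norm (c * t ^ n / fact n) * (M * (fact n / R ^ n)))" .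
  next
    fix l assume l: "l \<in> hankel_path \<rho>"
    have e: "exp ((- x - 1) * (l - \<i> * of_real pi)) = exp (- (x + 1) * l) * exp (\<i> * of_real pi * (x + 1))"
      by (simp add: algebra_simps flip: exp_add)
    have "F n l = exp (exp l) * exp ((- x - 1) * (l - \<i> * of_real pi)) * exp (- l / 2) * rGamma (- x) * (bessel_gen (\<nu> n) l / fact n * t ^ n)" for n
      unfolding F_def bessel_kernel_eq_bessel_gen c_def e by simp
    then show "(\<lambda>n. F n l) sums (exp (exp l) * exp ((- x - 1) * (l - \<i> * of_real pi)) * exp (- l / 2) * f l * rGamma (- x))"
      using sums_mult[OF f[OF l], of "exp (exp l) * exp ((- x - 1) * (l - \<i> * of_real pi)) * exp (- l / 2) * rGamma (- x)"]
      by (simp add: mult_ac)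
  qed
  from sums_mult[OF this, of "hankel_prefactor x"]
  have "(\<lambda>n. hankel_prefactor x * hankel_integral \<rho> (F n)) sums (hankel_prefactor x * hankel_integral \<rho>
      (\<lambda>l. exp (exp l) * exp ((- x - 1) * (l - \<i> * of_real pi)) * exp (- l / 2) * f l * rGamma (- x)))" .
  moreover have "hankel_prefactor x * hankel_integral \<rho> (F n) = dBesselJ (\<nu> n) x * t ^ n / fact n" for n
  proof -
    have "hankel_prefactor x * hankel_integral \<rho> (F n)
        = (hankel_prefactor x * c) * hankel_integral \<rho> (bessel_kernel (\<nu> n) x 1) * t ^ n / fact n"
      unfolding F_def hankel_integral_cmult by simp
    also have "hankel_prefactor x * c = Gamma (x + 1) / (2 * \<i> * of_real pi)"
      unfolding c_def by (rule hankel_constant[OF x])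
    finally show ?thesis unfolding J .
  qed
  ultimately show ?thesis by simp
qed

text \<open>\<open>dBesselJ\<close> does not involve \<rho>, so the contour may be chosen after the
  compact set. The factor \<open>Gamma (x + 1)\<close> is bounded on \<open>K\<close>, being
  continuous away from its poles, and the integral is bounded uniformly in x.\<close>

lemma uniform_limit_dBesselJ_series:
  fixes \<nu> :: "nat \<Rightarrow> complex"
  assumes bound: "\<And>R. R > 0 \<Longrightarrow> \<exists>\<rho>>0. \<exists>B\<ge>0. \<forall>n. \<forall>\<rho>'. \<rho> / 2 \<le> \<rho>' \<longrightarrow> \<rho>' \<le> \<rho> \<longrightarrow> (\<forall>l \<in> hankel_path \<rho>'.
      norm (bessel_gen (\<nu> n) l) \<le> fact n * B / R ^ n * exp (exp (Re l) / 2))"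
    and K: "compact K"
    and K_sub: "K \<subseteq> {(x, t). x + 1 \<notin> \<int>\<^sub>\<le>\<^sub>0 \<and> (\<forall>n. summable (dBessel_term (\<nu> n) x))}"
  shows "uniform_limit K
    (\<lambda>N (x, t). \<Sum>n<N. dBesselJ (\<nu> n) x * t ^ n / fact n)
    (\<lambda>(x, t). \<Sum>n. dBesselJ (\<nu> n) x * t ^ n / fact n) sequentially"
proof -
  obtain T where T: "\<And>p. p \<in> K \<Longrightarrow> norm p \<le> T" "T > 0"
    using compact_imp_bounded[OF K] by (auto simp: bounded_pos)
  have xt: "norm x \<le> T" "norm t \<le> T" if "(x, t) \<in> K" for x t
    using T(1)[OF that] norm_fst_le[of x t] norm_snd_le[of t x] by linarith+
  \<comment> \<open>Twice the bound on |t|, so that the majorants are geometric of ratio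
    1/2.\<close>
  define R where "R = 2 * T"
  have R: "R > 0" using T by (simp add: R_def)
  from bound[OF R] obtain \<rho> B where \<rho>: "\<rho> > 0" and B: "B \<ge> 0"
    and bd: "\<And>n \<rho>' l. \<rho> / 2 \<le> \<rho>' \<Longrightarrow> \<rho>' \<le> \<rho> \<Longrightarrow> l \<in> hankel_path \<rho>' \<Longrightarrow>
      norm (bessel_gen (\<nu> n) l) \<le> fact n * B / R ^ n * exp (exp (Re l) / 2)" by blast
  have "\<And>n l. l \<in> hankel_path \<rho> \<Longrightarrow> norm (bessel_gen (\<nu> n) l) \<le> fact n * B / R ^ n * exp (exp (Re l) / 2)"
    using bd[of \<rho>] \<rho> by simp
  from hankel_bounded_bessel_kernel[OF \<rho> R B this, of T]
  obtain M where M: "0 \<le> M"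
    "\<And>n x. norm x \<le> T \<Longrightarrow> hankel_bounded \<rho> (bessel_kernel (\<nu> n) x 1) (M * (fact n / R ^ n))" by blast
  have "compact ((\<lambda>p. Gamma (fst p + 1)) ` K)"
  proof (rule compact_continuous_image[OF _ K])
    show "continuous_on K (\<lambda>p. Gamma (fst p + 1))"
      by (rule continuous_on_compose2[of "- \<int>\<^sub>\<le>\<^sub>0" Gamma K "\<lambda>p. fst p + 1"])
         (use K_sub in \<open>auto intro!: continuous_intros\<close>)
  qed
  then have "bounded ((\<lambda>p. Gamma (fst p + 1)) ` K)" by (rule compact_imp_bounded)
  then obtain G where G: "G > 0" "\<And>p. p \<in> K \<Longrightarrow> norm (Gamma (fst p + 1)) \<le> G"
    unfolding bounded_pos by blast
  define C where "C = G / (2 * pi) * (M * exp (- ln \<rho>) * (2 + 2 * pi))"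
  have "uniform_limit K
    (\<lambda>N p. \<Sum>n<N. dBesselJ (\<nu> n) (fst p) * snd p ^ n / fact n)
    (\<lambda>p. \<Sum>n. dBesselJ (\<nu> n) (fst p) * snd p ^ n / fact n) sequentially"
  proof (rule Weierstrass_m_test)
    fix n p assume p: "p \<in> K"
    obtain x t where xtp: "p = (x, t)" by (cases p)
    have summable: "summable (dBessel_term (\<nu> n) x)" using K_sub p xtp by auto
    have "dBesselJ (\<nu> n) x = Gamma (x + 1) / (2 * \<i> * of_real pi) * hankel_integral \<rho> (bessel_kernel (\<nu> n) x 1)"
    proof (rule dBesselJ_eq_hankel_of_bessel_gen[OF \<rho> summable])
      show "0 \<le> fact n * B / R ^ n" using B R by simp
    qed (rule bd)
    then have "norm (dBesselJ (\<nu> n) x) = norm (Gamma (x + 1)) / (2 * pi) * norm (hankel_integral \<rho> (bessel_kernel (\<nu> n) x 1))"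
      by (simp add: norm_mult norm_divide)
    also have "\<dots> \<le> G / (2 * pi) * (M * (fact n / R ^ n) * exp (- ln \<rho>) * (2 + 2 * pi))"
    proof (intro mult_mono divide_right_mono)
      show "norm (Gamma (x + 1)) \<le> G" using G(2)[OF p] xtp by simp
      show "norm (hankel_integral \<rho> (bessel_kernel (\<nu> n) x 1)) \<le> M * (fact n / R ^ n) * exp (- ln \<rho>) * (2 + 2 * pi)"
        by (rule hankel_bounded.norm_hankel_integral_le[OF M(2)]) (use xt p xtp in auto)
    qed (use G in auto)
    also have "\<dots> = C * (fact n / R ^ n)" by (simp add: C_def)
    finally have "norm (dBesselJ (\<nu> n) x) * norm t ^ n / fact n \<le> C * (fact n / R ^ n) * T ^ n / fact n"
      using xt[of x t] p xtp by (intro divide_right_mono mult_mono power_mono) (auto intro: order.trans[OF norm_ge_zero])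
    also have "\<dots> = C * (1 / 2) ^ n"
      using T(2) by (simp add: R_def power_divide power_mult_distrib)
    finally show "norm (dBesselJ (\<nu> n) (fst p) * snd p ^ n / fact n) \<le> C * (1 / 2) ^ n"
      by (simp add: xtp norm_mult norm_divide norm_power)
  next
    show "summable (\<lambda>n. C * (1 / 2) ^ n)" by (intro summable_mult summable_geometric) simp
  qed
  then show ?thesis by (simp add: case_prod_unfold)
qed

section \<open>Bounds uniform in the radius, and conclusion\<close>

lemma norm_bessel_gen_cos_le':
  assumes "l \<in> hankel_path \<rho>'" "0 < \<rho>'" "\<rho>' \<le> \<rho>" "R > 0"
  shows "norm (bessel_gen (of_nat n - 1 / 2) l) \<le> fact n * exp (\<rho> + R) / R ^ n * exp (exp (Re l) / 2)"
proof -
  have "fact n * exp (\<rho>' + R + exp (Re l) / 2) / R ^ n \<le> fact n * exp (\<rho> + R + exp (Re l) / 2) / R ^ n"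
    using assms by (intro divide_right_mono mult_left_mono) auto
  with norm_bessel_gen_cos_le[OF assms(1,2,4), of n] show ?thesis by (simp add: exp_add)
qed

lemma norm_bessel_gen_sin_le':
  assumes "l \<in> hankel_path \<rho>'" "0 < \<rho>'" "\<rho>' \<le> \<rho>" "R > 0" "2 * R < \<rho>'"
  shows "norm (bessel_gen (- of_nat n + 1 / 2) l) \<le> fact n * exp (\<rho> + R) / R ^ n * exp (exp (Re l) / 2)"
proof -
  have "fact n * exp (\<rho>' + R + exp (Re l) / 2) / R ^ n \<le> fact n * exp (\<rho> + R + exp (Re l) / 2) / R ^ n"
    using assms by (intro divide_right_mono mult_left_mono) auto
  with norm_bessel_gen_sin_le[OF assms(1,2,4,5), of n] show ?thesis by (simp add: exp_add)
qed

text \<open>The conditions on the compact sets single out the points where the coefficients are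
  genuine: at a pole \<open>Gamma\<close> has the default value 0, and \<open>suminf\<close> of a
  divergent series means nothing. In the integral formulas \<open>x \<notin> \<int>\<close> keeps
  the denominator of \<open>hankel_prefactor\<close> away from 0.\<close>

theorem mainTheorem16:
  shows
   "(\<forall>K. compact K \<and>
        K \<subseteq> {(x, t). x + 1 \<notin> \<int>\<^sub>\<le>\<^sub>0 \<and>
                     (\<forall>n::nat. summable (dBessel_term (of_nat n - 1/2) x))}
      \<longrightarrow> uniform_limit K
            (\<lambda>N (x, t). \<Sum>n<N. dBesselJ (of_nat n - 1/2) x * t ^ n / fact n)
            (\<lambda>(x, t). \<Sum>n. dBesselJ (of_nat n - 1/2) x * t ^ n / fact n) sequentially)
  \<and> (\<forall>K. compact K \<and>
        K \<subseteq> {(x, t). x + 1 \<notin> \<int>\<^sub>\<le>\<^sub>0 \<and>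
                     (\<forall>n::nat. summable (dBessel_term (- of_nat n + 1/2) x))}
      \<longrightarrow> uniform_limit K
            (\<lambda>N (x, t). \<Sum>n<N. dBesselJ (- of_nat n + 1/2) x * t ^ n / fact n)
            (\<lambda>(x, t). \<Sum>n. dBesselJ (- of_nat n + 1/2) x * t ^ n / fact n) sequentially)
  \<and> (\<forall>x t \<rho>. x \<notin> \<int> \<and> 0 < \<rho> \<and>
        (\<forall>n::nat. summable (dBessel_term (of_nat n - 1/2) x)) \<longrightarrow>
        hankel_prefactor x * hankel_integral \<rho> (hankel_cos_integrand x t)
          = (\<Sum>n. dBesselJ (of_nat n - 1/2) x * t ^ n / fact n))
  \<and> (\<forall>x t \<rho>. x \<notin> \<int> \<and> 2 * cmod t < \<rho> \<and>
        (\<forall>n::nat. summable (dBessel_term (- of_nat n + 1/2) x)) \<longrightarrow>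
        hankel_prefactor x * hankel_integral \<rho> (hankel_sin_integrand x t)
          = (\<Sum>n. dBesselJ (- of_nat n + 1/2) x * t ^ n / fact n))"
proof (intro conjI allI impI; elim conjE)
  fix K :: "(complex \<times> complex) set"
  assume K: "compact K" "K \<subseteq> {(x, t). x + 1 \<notin> \<int>\<^sub>\<le>\<^sub>0 \<and> (\<forall>n::nat. summable (dBessel_term (of_nat n - 1/2) x))}"
  show "uniform_limit K
            (\<lambda>N (x, t). \<Sum>n<N. dBesselJ (of_nat n - 1/2) x * t ^ n / fact n)
            (\<lambda>(x, t). \<Sum>n. dBesselJ (of_nat n - 1/2) x * t ^ n / fact n) sequentially"
  proof (rule uniform_limit_dBesselJ_series[OF _ K])
    fix R :: real assume "R > 0"
    then show "\<exists>\<rho>>0. \<exists>B\<ge>0. \<forall>n. \<forall>\<rho>'. \<rho> / 2 \<le> \<rho>' \<longrightarrow> \<rho>' \<le> \<rho> \<longrightarrow> (\<forall>l \<in> hankel_path \<rho>'.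
      norm (bessel_gen (of_nat n - 1 / 2) l) \<le> fact n * B / R ^ n * exp (exp (Re l) / 2))"
      by (intro exI[of _ 1] conjI exI[of _ "exp (1 + R)"] allI impI ballI norm_bessel_gen_cos_le') auto
  qed
next
  fix K :: "(complex \<times> complex) set"
  assume K: "compact K" "K \<subseteq> {(x, t). x + 1 \<notin> \<int>\<^sub>\<le>\<^sub>0 \<and> (\<forall>n::nat. summable (dBessel_term (- of_nat n + 1/2) x))}"
  show "uniform_limit K
            (\<lambda>N (x, t). \<Sum>n<N. dBesselJ (- of_nat n + 1/2) x * t ^ n / fact n)
            (\<lambda>(x, t). \<Sum>n. dBesselJ (- of_nat n + 1/2) x * t ^ n / fact n) sequentially"
  proof (rule uniform_limit_dBesselJ_series[OF _ K])
    fix R :: real assume "R > 0"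
    then show "\<exists>\<rho>>0. \<exists>B\<ge>0. \<forall>n. \<forall>\<rho>'. \<rho> / 2 \<le> \<rho>' \<longrightarrow> \<rho>' \<le> \<rho> \<longrightarrow> (\<forall>l \<in> hankel_path \<rho>'.
      norm (bessel_gen (- of_nat n + 1 / 2) l) \<le> fact n * B / R ^ n * exp (exp (Re l) / 2))"
      \<comment> \<open>With \<rho> = 8 R every \<rho>' \<ge> \<rho>/2 = 4 R satisfies the
        requirement \<open>2 * R < \<rho>'\<close>.\<close>
      by (intro exI[of _ "8 * R"] conjI exI[of _ "exp (8 * R + R)"] allI impI ballI norm_bessel_gen_sin_le') auto
  qed
next
  fix x t :: complex and \<rho> :: real
  assume x: "x \<notin> \<int>" and \<rho>: "0 < \<rho>" and summable: "\<forall>n::nat. summable (dBessel_term (of_nat n - 1/2) x)"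
  define R where "R = norm t + 1"
  have R: "R > 0" "norm t < R" by (auto simp: R_def add_nonneg_pos)
  have "dBesselJ (of_nat n - 1 / 2) x = Gamma (x + 1) / (2 * \<i> * of_real pi) * hankel_integral \<rho> (bessel_kernel (of_nat n - 1 / 2) x 1)" for n
  proof (rule dBesselJ_eq_hankel_of_bessel_gen[OF \<rho>])
    show "norm (bessel_gen (of_nat n - 1 / 2) l) \<le> fact n * exp (\<rho> + R) / R ^ n * exp (exp (Re l) / 2)"
      if "\<rho> / 2 \<le> \<rho>'" "\<rho>' \<le> \<rho>" "l \<in> hankel_path \<rho>'" for \<rho>' l
      using that R \<rho> by (intro norm_bessel_gen_cos_le'[where \<rho>' = \<rho>']) auto
  qed (use summable R in auto)
  from hankel_generating_function[OF x \<rho> R(2) _ norm_bessel_gen_cos_le'[OF _ \<rho> order_refl R(1)] this cos_bessel_gen_sums]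
  show "hankel_prefactor x * hankel_integral \<rho> (hankel_cos_integrand x t)
          = (\<Sum>n. dBesselJ (of_nat n - 1/2) x * t ^ n / fact n)"
    by (simp add: sums_iff hankel_cos_integrand_def[abs_def])
next
  fix x t :: complex and \<rho> :: real
  assume x: "x \<notin> \<int>" and t: "2 * norm t < \<rho>" and summable: "\<forall>n::nat. summable (dBessel_term (- of_nat n + 1/2) x)"
  have \<rho>: "0 < \<rho>" using t norm_ge_zero[of t] by linarith
  \<comment> \<open>The midpoint of |t| and \<rho>/2: above |t| for the geometric series, below
    \<rho>/2 for the branch of the root.\<close>
  define R where "R = (norm t + \<rho> / 2) / 2"
  have R: "norm t < R" "2 * R < \<rho>" using t by (auto simp: R_def)
  then have R0: "R > 0" using norm_ge_zero[of t] by linarith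
  have J: "dBesselJ (- of_nat n + 1 / 2) x = Gamma (x + 1) / (2 * \<i> * of_real pi) * hankel_integral \<rho> (bessel_kernel (- of_nat n + 1 / 2) x 1)" for n
  proof (rule dBesselJ_eq_hankel_of_bessel_gen[OF \<rho>])
    \<comment> \<open>The \<open>R\<close> above may fail \<open>2 * R < \<rho>'\<close> on the
      smaller contours. For fixed \<open>n\<close> any Cauchy radius is good, and \<rho>/8 fits all
      \<rho>' \<ge> \<rho>/2.\<close>
    show "norm (bessel_gen (- of_nat n + 1 / 2) l) \<le> fact n * exp (\<rho> + \<rho> / 8) / (\<rho> / 8) ^ n * exp (exp (Re l) / 2)"
      if "\<rho> / 2 \<le> \<rho>'" "\<rho>' \<le> \<rho>" "l \<in> hankel_path \<rho>'" for \<rho>' l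
      using that \<rho> by (intro norm_bessel_gen_sin_le'[where \<rho>' = \<rho>']) auto
  qed (use summable \<rho> in auto)
  have f: "(\<lambda>n. bessel_gen (- of_nat n + 1 / 2) l / fact n * t ^ n) sums sin (exp l * csqrt (1 + 2 * t / exp l))"
    if "l \<in> hankel_path \<rho>" for l
  proof (rule sin_bessel_gen_sums)
    have "exp (ln \<rho>) \<le> exp (Re l)" unfolding exp_le_cancel_iff by (rule hankel_pathD(1)[OF that])
    then show "norm t < exp (Re l) / 2" using \<rho> t by simp
  qed
  from hankel_generating_function[OF x \<rho> R(1) _ norm_bessel_gen_sin_le'[OF _ \<rho> order_refl R0 R(2)] J f]
  show "hankel_prefactor x * hankel_integral \<rho> (hankel_sin_integrand x t)
          = (\<Sum>n. dBesselJ (- of_nat n + 1/2) x * t ^ n / fact n)"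
    by (simp add: sums_iff hankel_sin_integrand_def[abs_def])
qed

end
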